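(* Let $\mathbb{D}=\mathbb{D}(A)$ be the all-$A$ dessin of a connected link projection of a link $L$ and let $\mathbb{D}^*$ be its dual. Suppose $\mathbb{D}$ has genus one. Then $$\det(L)=\bigl|\,\#\{\text{spanning trees in }\mathbb{D}\}-\#\{\text{spanning trees in }\mathbb{D}^*\}\,\bigr|.$$
   Context: The determinant $\det(L)$ of a link $L$ is the absolute value of its Jones polynomial (equivalently, of its Alexander polynomial) at $-1$; it is the order of the first homology of the double branched cover (read as $0$ if infinite). A dessin (d'enfant; combinatorial map, oriented ribbon graph) is a finite multigraph (loops and multiple edges allowed) with a cyclic order on the edge-ends at each vertex; equivalently a graph embedded in an orientable surface so that all complementary regions (faces) are disks. For a dessin $\mathbb{D}$, let $v,e,f,k$ denote the numbers of vertices, edges, faces and connected components. The genus is $g(\mathbb{D})=\frac{2k(\mathbb{D})-v(\mathbb{D})+e(\mathbb{D})-f(\mathbb{D})}{2}$. The dual $\mathbb{D}^*$ is the dual embedded graph on the same surface (vertices are the faces of $\mathbb{D}$, edges correspond to edges of $\mathbb{D}$). Spanning trees are spanning trees of the underlying multigraphs. All-$A$ dessin $\mathbb{D}(A)$ of a link diagram $P$: at each crossing the $A$-splicing is the smoothing that joins the two regions swept out when the over-strand is rotated counterclockwise onto the under-strand (the $B$-splicing is the other smoothing). Splice every crossing by its $A$-splicing to get disjoint circles in the plane, together with one arc per crossing recording the splice. Vertices of $\mathbb{D}(A)$ are the circles, edges are the crossings (arcs). Orient each circle clockwise or anti-clockwise according to whether it lies inside an odd or even number of the circles; the cyclic order at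 a vertex is the order in which arc-ends are met along the oriented circle. *)

theory Defs
  imports "HOL-Analysis.Analysis" "HOL-Combinatorics.Orbits"
begin

section \<open>Dessins\<close>

text \<open>
  A dessin is encoded by its set of edge-ends (darts), the permutation \<open>rot\<close> sending a dart to
  the next one in the cyclic order at its vertex, and the fixed-point free involution \<open>flip\<close>
  exchanging the two ends of each edge.  Vertices are the cycles of \<open>rot\<close>, so isolated vertices are
  not represented.  Cyclic orders are read counterclockwise.
\<close>

record 'd dessin =
  darts :: "'d set"
  rot :: "'d \<Rightarrow> 'd"
  flip :: "'d \<Rightarrow> 'd"

definition dessin :: "'d dessin \<Rightarrow> bool" where
  "dessin D \<longleftrightarrow> finite (darts D) \<and> rot D permutes darts D \<and> flip D permutes darts D \<and>
     (\<forall>d\<in>darts D. flip D d \<noteq> d \<and> flip D (flip D d) = d)"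

definition vertex_at :: "'d dessin \<Rightarrow> 'd \<Rightarrow> 'd set" where
  "vertex_at D d = orbit (rot D) d"

definition edge_at :: "'d dessin \<Rightarrow> 'd \<Rightarrow> 'd set" where
  "edge_at D d = {d, flip D d}"

text \<open>
  Walking out along \<open>d\<close>, arriving at the dart \<open>flip D d\<close>, and leaving by the dart that
  precedes it counterclockwise keeps one face on the left.  The cycle of \<open>d\<close> is thus the face on the
  left of \<open>d\<close>, traversed counterclockwise; that face also contains the corner between \<open>d\<close> and
  \<open>rot D d\<close>.
\<close>

definition face_next :: "'d dessin \<Rightarrow> 'd \<Rightarrow> 'd" where
  "face_next D d = inv (rot D) (flip D d)"

definition vertices :: "'d dessin \<Rightarrow> 'd set set" where
  "vertices D = vertex_at D ` darts D"

definition edges :: "'d dessin \<Rightarrow> 'd set set" where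
  "edges D = edge_at D ` darts D"

definition faces :: "'d dessin \<Rightarrow> 'd set set" where
  "faces D = orbit (face_next D) ` darts D"

definition adjacency :: "'d dessin \<Rightarrow> 'd set set \<Rightarrow> ('d set \<times> 'd set) set" where
  "adjacency D T =
     {(vertex_at D d, vertex_at D (flip D d)) | d. d \<in> darts D \<and> edge_at D d \<in> T}"

definition graph_components :: "'d dessin \<Rightarrow> 'd set set \<Rightarrow> 'd set set set" where
  "graph_components D T = vertices D // (adjacency D T)\<^sup>*"

definition genus :: "'d dessin \<Rightarrow> real" where
  "genus D =
     (2 * real (card (graph_components D (edges D)))
       - real (card (vertices D)) + real (card (edges D)) - real (card (faces D))) / 2"

text \<open>
  The dart \<open>d\<close> of the dual is the end, in the face on the left of \<open>d\<close>, of the dual edge crossing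
  the edge of \<open>d\<close>.
\<close>

definition dual :: "'d dessin \<Rightarrow> 'd dessin" where
  "dual D = \<lparr>darts = darts D, rot = face_next D, flip = flip D\<rparr>"

text \<open>A cycle is given by its successive outgoing darts; a loop has length 1.\<close>

definition is_cycle :: "'d dessin \<Rightarrow> 'd list \<Rightarrow> bool" where
  "is_cycle D ds \<longleftrightarrow> ds \<noteq> [] \<and> set ds \<subseteq> darts D \<and>
     distinct (map (edge_at D) ds) \<and> distinct (map (vertex_at D) ds) \<and>
     (\<forall>i<length ds.
        vertex_at D (flip D (ds ! i)) = vertex_at D (ds ! (Suc i mod length ds)))"

definition spanning_trees :: "'d dessin \<Rightarrow> 'd set set set" where
  "spanning_trees D =
     {T. T \<subseteq> edges D \<and> card (graph_components D T) = 1 \<and>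
         \<not> (\<exists>ds. is_cycle D ds \<and> edge_at D ` set ds \<subseteq> T)}"


section \<open>Link diagrams\<close>

text \<open>
  The shadow is the underlying 4-valent plane graph, with \<open>rot\<close> the counterclockwise rotation at
  the crossings; \<open>over\<close> is the set of darts on over-strands; \<open>out\<close> is the set of darts along
  which the orientation of the link leaves a crossing; \<open>outer\<close> is the unbounded face.
\<close>

record 'd link_diagram =
  shadow :: "'d dessin"
  over :: "'d set"
  out :: "'d set"
  outer :: "'d set"

abbreviation crossings :: "'d link_diagram \<Rightarrow> 'd set set" where
  "crossings P \<equiv> vertices (shadow P)"

text \<open>
  A connected plane map is a connected combinatorial map of genus 0 on the sphere together with
  a choice of unbounded face.  The diagram consisting of one circle without crossings is not
  represented; its all-A dessin is a single vertex, of genus 0.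
\<close>

definition connected_link_diagram :: "'d link_diagram \<Rightarrow> bool" where
  "connected_link_diagram P \<longleftrightarrow> (let G = shadow P in
     dessin G \<and>
     card (graph_components G (edges G)) = 1 \<and>
     genus G = 0 \<and>
     outer P \<in> faces G \<and>
     (\<forall>x\<in>vertices G. card x = 4) \<and>
     over P \<subseteq> darts G \<and> (\<forall>d\<in>darts G. rot G d \<in> over P \<longleftrightarrow> d \<notin> over P) \<and>
     out P \<subseteq> darts G \<and> (\<forall>d\<in>darts G. flip G d \<in> out P \<longleftrightarrow> d \<notin> out P) \<and>
     (\<forall>d\<in>darts G. rot G (rot G d) \<in> out P \<longleftrightarrow> d \<notin> out P))"

text \<open>
  \<open>splice P S\<close> pairs the darts joined by a strand after B-splicing the crossings in \<open>S\<close> and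
  A-splicing all others.  Turning an over-dart \<open>d\<close> counterclockwise sweeps the corner between \<open>d\<close>
  and \<open>rot d\<close>.  The A-splicing joins the two swept corners, so it connects each over-dart to the
  preceding under-dart; the B-splicing connects it to the following one.
\<close>

definition splice :: "'d link_diagram \<Rightarrow> 'd set set \<Rightarrow> 'd \<Rightarrow> 'd" where
  "splice P S d = (let G = shadow P in
     if vertex_at G d \<in> S
     then (if d \<in> over P then rot G d else inv (rot G) d)
     else (if d \<in> over P then inv (rot G) d else rot G d))"

text \<open>A circle of a state is represented by the set of darts lying on it.\<close>

definition circles :: "'d link_diagram \<Rightarrow> 'd set set \<Rightarrow> 'd set set" where
  "circles P S = darts (shadow P) //
     ({(d, flip (shadow P) d) | d. d \<in> darts (shadow P)} \<union>
      {(d, splice P S d) | d. d \<in> darts (shadow P)})\<^sup>*"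


section \<open>Jones polynomial and determinant\<close>

text \<open>The Kauffman bracket as a sum over states, normalised to 1 on the unknotted circle.\<close>

definition kauffman_bracket :: "'d link_diagram \<Rightarrow> complex \<Rightarrow> complex" where
  "kauffman_bracket P A =
     (\<Sum>S\<in>Pow (crossings P).
        A powi (int (card (crossings P - S)) - int (card S)) *
        (- (A ^ 2) - A powi (-2)) ^ (card (circles P S) - 1))"

text \<open>
  Each crossing has exactly one outgoing over-dart \<open>d\<close>; it is positive iff turning the over-direction
  counterclockwise by a right angle gives the under-direction.
\<close>

definition writhe :: "'d link_diagram \<Rightarrow> int" where
  "writhe P = (\<Sum>d\<in>over P \<inter> out P. if rot (shadow P) d \<in> out P then 1 else -1)"

text \<open>
  The value at \<open>t\<close> of the Jones polynomial, which is a Laurent polynomial in the square root of \<open>t\<close>;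
  the substitution is \<open>t = A\<^sup>-\<^sup>4\<close>, with the principal branch of the root.
\<close>

definition jones :: "'d link_diagram \<Rightarrow> complex \<Rightarrow> complex" where
  "jones P t = (let A = t powr (- 1 / 4) in
     (- (A ^ 3)) powi (- writhe P) * kauffman_bracket P A)"

text \<open>
  The determinant of the link presented by \<open>P\<close>.  Other choices of the root or of
  the orientation change the value of the Jones polynomial at \<open>-1\<close> only by a unit complex factor.
\<close>

definition link_det :: "'d link_diagram \<Rightarrow> real" where
  "link_det P = cmod (jones P (-1))"


section \<open>The all-A dessin\<close>

abbreviation A_circles :: "'d link_diagram \<Rightarrow> 'd set set" where
  "A_circles P \<equiv> circles P {}"

text \<open>
  Two darts are related if their left sides lie in the same component of the plane minus
  the all-A circle \<open>C\<close>: one may move inside a face, pass through a crossing between the two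
  corners joined by its A-splicing, and cross any other circle (the right side of \<open>d\<close>
  is the left side of \<open>flip d\<close>).
\<close>

definition same_side :: "'d link_diagram \<Rightarrow> 'd set \<Rightarrow> ('d \<times> 'd) set" where
  "same_side P C = (let G = shadow P in
     ({(d, face_next G d) | d. d \<in> darts G} \<union>
      {(d, rot G (rot G d)) | d. d \<in> over P} \<union>
      {(d, flip G d) | d. d \<in> darts G - C})\<^sup>*)"

definition enclosed :: "'d link_diagram \<Rightarrow> 'd set \<Rightarrow> 'd set" where
  "enclosed P C = darts (shadow P) - same_side P C `` outer P"

definition nesting_depth :: "'d link_diagram \<Rightarrow> 'd set \<Rightarrow> nat" where
  "nesting_depth P C = card {C' \<in> A_circles P. C' \<noteq> C \<and> C \<subseteq> enclosed P C'}"

text \<open>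
  The darts pointing in the direction of the oriented circles.  A dart \<open>d\<close> on \<open>C\<close> points
  counterclockwise along \<open>C\<close> iff the interior of \<open>C\<close> is on its left.
\<close>

definition forward :: "'d link_diagram \<Rightarrow> 'd set" where
  "forward P = {d. \<exists>C\<in>A_circles P. d \<in> C \<and>
     (if odd (nesting_depth P C) then d \<notin> enclosed P C else d \<in> enclosed P C)}"

text \<open>
  The A-splicing of a crossing leaves two strands, each made of one under-dart \<open>d\<close> and
  the over-dart \<open>rot d\<close>.  The arc-end on this strand is represented by \<open>d\<close>, so the other end of
  the same arc is \<open>rot (rot d)\<close>.  The next arc-end along the circle is found by leaving the
  strand through whichever of \<open>d\<close>, \<open>rot d\<close> points forward.
\<close>

definition next_arc_end :: "'d link_diagram \<Rightarrow> 'd \<Rightarrow> 'd" where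
  "next_arc_end P d = (let G = shadow P;
       e = flip G (if d \<in> forward P then d else rot G d)
     in if e \<in> over P then inv (rot G) e else e)"

definition all_A_dessin :: "'d link_diagram \<Rightarrow> 'd dessin" where
  "all_A_dessin P = (let G = shadow P; E = darts G - over P in
     \<lparr>darts = E,
      rot = (\<lambda>d. if d \<in> E then next_arc_end P d else d),
      flip = (\<lambda>d. if d \<in> E then rot G (rot G d) else d)\<rparr>)"

end

theory Submission
  imports Defs
begin

text \<open>
  At \<open>t = -1\<close> the bracket variable satisfies \<open>A\<^sup>-\<^sup>2 = \<i>\<close>, so the loop factor \<open>- A\<^sup>2 - A\<^sup>-\<^sup>2\<close> vanishes and
  only the states consisting of a single circle survive.  Up to a unit factor, the Jones polynomial
  at \<open>-1\<close> is the sum of \<open>\<i> ^ card S\<close> over the sets \<open>S\<close> of B-spliced crossings whose state is one circle.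

  Replacing an A-splicing by a B-splicing inserts a band between the discs bounded by the all-A
  circles.  The state of \<open>S\<close> is therefore the boundary of the ribbon subgraph of the all-A dessin \<open>D\<close>
  that has all vertices and the edges \<open>S\<close> (\<open>boundary_count_circles\<close>).  Adding a band composes the
  boundary permutation with a transposition, so it changes the number of boundary circles by
  exactly one.  Starting from the \<open>v\<close> vertex circles, one circle can be reached only
  with \<open>v - 1\<close> edges or more, and only with a number of the parity of \<open>v - 1\<close>.  The complement of
  \<open>S\<close> in the dual has the same boundary, and in genus one this gives \<open>card S \<le> v + 1\<close>
  (\<open>genus_one_one_boundary\<close>).  The sets with one boundary circle and \<open>v - 1\<close> edges are the spanning
  trees (\<open>spanning_tree_iff_boundary_count\<close>); by duality those with \<open>v + 1\<close> edges are
  the complements of the spanning trees of the dual.  The powers \<open>\<i> ^ (v - 1)\<close> and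
  \<open>\<i> ^ (v + 1)\<close> are opposite, whence the difference.

  A boundary walk that follows the oriented circles and crosses bands traces the state only if the
  orientation of the circles makes every band untwisted.  Each edge of the diagram is
  traversed in one direction by the circle through it, and the condition is that these directions
  alternate around every crossing (\<open>forward_rot\<close>).  The rule by
  nesting depth amounts to calling a dart forward iff its left side is enclosed by an odd number of
  all-A circles (\<open>forward_iff\<close>), so the alternation follows from the Jordan curve theorem
  for these circles (\<open>enclosed_separates\<close>).  That theorem comes from the vanishing of the
  first cohomology of a plane map with coefficients in \<open>\<int>/2\<close> (\<open>planar_cycle_is_coboundary\<close>), which is
  Euler's formula turned into a count of cochains.
\<close>

section \<open>Cycles of a permutation\<close>

abbreviation cycle_count :: "('a \<Rightarrow> 'a) \<Rightarrow> 'a set \<Rightarrow> nat" where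
  "cycle_count p A \<equiv> card (orbit p ` A)"

lemma card_image_le_kernel:
  assumes fin: "finite A" and ker: "\<And>x y. x \<in> A \<Longrightarrow> y \<in> A \<Longrightarrow> f x = f y \<Longrightarrow> g x = g y"
  shows "card (g ` A) \<le> card (f ` A)"
proof -
  have "g x = g (inv_into A f (f x))" if "x \<in> A" for x
    using that by (intro ker) (auto intro: inv_into_into simp: f_inv_into_f)
  then have "g ` A = (\<lambda>z. g (inv_into A f z)) ` f ` A" by (simp add: image_image)
  then show ?thesis using fin by (simp add: card_image_le)
qed

lemma orbit_eq_iff:
  assumes "permutation p"
  shows "orbit p x = orbit p y \<longleftrightarrow> x \<in> orbit p y"
  using assms
  by (metis cyclic_on_orbit' orbit_cyclic_eq3 permutation_self_in_orbit)

lemma orbit_subset_closed: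
  assumes "x \<in> U" "\<And>y. y \<in> U \<Longrightarrow> p y \<in> U"
  shows "orbit p x \<subseteq> U"
proof
  fix y assume "y \<in> orbit p x"
  then show "y \<in> U" by induction (auto intro: assms)
qed

lemma orbit_closed_permutation:
  assumes "permutation p"
  shows "p y \<in> orbit p x \<longleftrightarrow> y \<in> orbit p x"
  by (metis assms orbit_eq_iff permutation_orbit_step)

lemma cycle_count_conj:
  assumes p: "permutation p" and q: "permutation q" and h: "bij_betw h A B"
    and pA: "\<And>x. x \<in> A \<Longrightarrow> p x \<in> A"
    and eq: "\<And>x. x \<in> A \<Longrightarrow> h (p x) = q (h x)"
  shows "cycle_count q B = cycle_count p A"
proof -
  have sub: "orbit p x \<subseteq> A" if "x \<in> A" for x
    using that pA by (rule orbit_subset_closed)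
  have im: "orbit q (h x) = h ` orbit p x" if "x \<in> A" for x
    using orbit_inverse[of x p q h] permutation_self_in_orbit[OF p] sub[OF that] eq
    by (metis subsetD)
  have "orbit q ` B = (\<lambda>O'. h ` O') ` (orbit p ` A)"
    using h im by (auto simp: bij_betw_def image_image)
  moreover have "inj_on (\<lambda>O'. h ` O') (orbit p ` A)"
  proof (rule inj_on_subset)
    show "inj_on ((`) h) (Pow A)"
      using h by (simp add: bij_betw_def inj_on_image_Pow)
  qed (use sub in auto)
  ultimately show ?thesis by (simp add: card_image)
qed

text \<open>
  If the \<open>p\<close>-cycle of \<open>a\<close> misses \<open>b\<close>, the modified permutation follows it until it would return to \<open>a\<close>,
  and is there diverted to \<open>b\<close>.
\<close>

lemma orbit_transpose_cases:
  assumes p: "permutation p"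
  shows "b \<in> orbit p a \<or> b \<in> orbit (Transposition.transpose a b \<circ> p) a"
proof (rule ccontr)
  let ?q = "Transposition.transpose a b \<circ> p"
  assume "\<not> ?thesis"
  then have nb: "b \<notin> orbit p a" and nq: "b \<notin> orbit ?q a" by auto
  have *: "x \<in> orbit ?q a \<and> x \<noteq> b \<and> x \<in> orbit p a" if "x \<in> orbit p a" for x
    using that
  proof induction
    case base
    have "p a \<noteq> b" using nb orbit.base[of p a] by auto
    moreover have "p a \<noteq> a" using nq orbit.base[of ?q a] by (auto simp: Transposition.transpose_def)
    ultimately have "?q a = p a" by (simp add: Transposition.transpose_def)
    then show ?case using orbit.base[of ?q a] orbit.base[of p a] \<open>p a \<noteq> b\<close> by metis
  next
    case (step x)
    have "p x \<in> orbit p a" using step by (auto intro: orbit.step)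
    then have "p x \<noteq> b" using nb by auto
    have "?q x \<in> orbit ?q a" using step by (blast intro: orbit.step)
    moreover from this have "p x \<noteq> a" using nq by auto
    moreover from this have "?q x = p x"
      using \<open>p x \<noteq> b\<close> by (simp add: Transposition.transpose_def)
    ultimately show ?case using \<open>p x \<noteq> b\<close> \<open>p x \<in> orbit p a\<close> by metis
  qed
  obtain x where x: "p x = a" using p by (metis permutation_bijective bij_pointE)
  then have "x \<in> orbit p a" 
    by (metis orbit_closed_permutation p permutation_self_in_orbit)
  then have "?q x \<in> orbit ?q a" using * by (blast intro: orbit.step)
  then show False using x nq by simp
qed

text \<open>
  The piece of the cycle that starts at \<open>a\<close> and stops just before \<open>b\<close> is now closed up into a cycle of
  its own.
\<close>

lemma orbit_transpose_split:
  assumes p: "permutation p" and ab: "a \<noteq> b" and b: "b \<in> orbit p a"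
  shows "b \<notin> orbit (Transposition.transpose a b \<circ> p) a"
proof -
  let ?q = "Transposition.transpose a b \<circ> p"
  have ex: "\<exists>n. (p ^^ n) a = b" using b by (auto simp: orbit_altdef)
  define k where "k = (LEAST n. (p ^^ n) a = b)"
  have k: "(p ^^ k) a = b" unfolding k_def using ex by (rule LeastI_ex)
  have least: "(p ^^ n) a \<noteq> b" if "n < k" for n using that not_less_Least k_def by auto
  have k0: "0 < k" using k ab by (cases k) auto
  have na: "(p ^^ j) a \<noteq> a" if "0 < j" "j \<le> k" for j
  proof
    assume j: "(p ^^ j) a = a"
    have "b = (p ^^ (k - j + j)) a" using k that by simp
    also have "\<dots> = (p ^^ (k - j)) a" unfolding funpow_add using j by simp
    finally show False using least[of "k - j"] that by simp
  qed
  \<comment> \<open>the segment of the cycle from a to the predecessor of b\<close>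
  define W where "W = {(p ^^ j) a |j. j < k}"
  have aW: "a \<in> W" unfolding W_def using k0 by (intro CollectI exI[of _ 0]) simp
  have "?q y \<in> W" if y: "y \<in> W" for y
  proof -
    obtain j where j: "j < k" "y = (p ^^ j) a" using y unfolding W_def by blast
    show ?thesis
    proof (cases "Suc j = k")
      case True
      then have "?q y = a" using j k by auto
      then show ?thesis using aW by simp
    next
      case False
      then have sj: "Suc j < k" using j by simp
      have "p y \<noteq> a" "p y \<noteq> b" using na[of "Suc j"] least[of "Suc j"] sj j by auto
      then have "?q y = (p ^^ Suc j) a" using j by (simp add: Transposition.transpose_def)
      then show ?thesis unfolding W_def using sj by blast
    qed
  qed
  then have "orbit ?q a \<subseteq> W" using aW by (intro orbit_subset_closed)
  moreover have "b \<notin> W" unfolding W_def using least by auto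
  ultimately show ?thesis by blast
qed

text \<open>
  By \<open>orbit_transpose_cases\<close> the cycles of \<open>a\<close> and \<open>b\<close> are joined into one; the others are untouched.
\<close>

lemma cycle_count_merge:
  assumes fin: "finite A" and p: "p permutes A" and ab: "a \<in> A" "b \<in> A"
    and nb: "b \<notin> orbit p a"
  shows "cycle_count p A = Suc (cycle_count (Transposition.transpose a b \<circ> p) A)"
proof -
  let ?q = "Transposition.transpose a b \<circ> p"
  have pp: "permutation p" using fin p by (auto simp: permutation_permutes)
  have qA: "?q permutes A" using p ab by (intro permutes_compose permutes_swap_id)
  have qq: "permutation ?q" using fin qA by (auto simp: permutation_permutes)
  let ?U = "orbit p a \<union> orbit p b"
  have other: "orbit ?q x = orbit p x" if "x \<notin> ?U" for x
  proof (rule orbit_cong)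
    show "x \<in> orbit p x" using pp by (rule permutation_self_in_orbit)
    fix y assume y: "y \<in> orbit p x"
    then have "p y \<in> orbit p x" by (rule orbit.step)
    then have "p y \<noteq> a" "p y \<noteq> b" using that orbit_eq_iff[OF pp] by (metis UnI1 UnI2)+
    then show "?q y = p y" by (simp add: Transposition.transpose_def)
  qed
  have ab_U: "a \<in> ?U" "b \<in> ?U" using permutation_self_in_orbit[OF pp] by auto
  have U_closed: "?q y \<in> ?U" if "y \<in> ?U" for y
  proof -
    have "p y \<in> ?U" using that by (auto intro: orbit.step)
    then show ?thesis using ab_U by (auto simp: Transposition.transpose_def)
  qed
  have bq: "b \<in> orbit ?q a" using orbit_transpose_cases[OF pp, of b a] nb by simp
  have closed: "p y \<in> orbit ?q a" if "y \<in> orbit ?q a" for y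
  proof -
    have "?q y \<in> orbit ?q a" using that by (rule orbit.step)
    moreover have "a \<in> orbit ?q a" using qq by (rule permutation_self_in_orbit)
    moreover have "p y = Transposition.transpose a b (?q y)" by simp
    ultimately show ?thesis using bq by (metis transpose_eq_iff)
  qed
  have qa: "orbit ?q a = ?U"
  proof
    show "orbit ?q a \<subseteq> ?U" using ab_U(1) U_closed by (rule orbit_subset_closed)
    show "?U \<subseteq> orbit ?q a"
      using closed bq permutation_self_in_orbit[OF qq]
      by (intro Un_least orbit_subset_closed)
  qed
  have inU: "orbit ?q x = ?U" if "x \<in> ?U" for x
    using that qa orbit_eq_iff[OF qq] by metis
  let ?R = "orbit p ` (A - ?U)"
  have p_im: "orbit p ` A = insert (orbit p a) (insert (orbit p b) ?R)"
  proof -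
    have "orbit p x \<in> insert (orbit p a) (insert (orbit p b) ?R)" if "x \<in> A" for x
      using that orbit_eq_iff[OF pp] by blast
    then show ?thesis using ab by blast
  qed
  have q_im: "orbit ?q ` A = insert ?U ?R"
  proof -
    have "A = (A \<inter> ?U) \<union> (A - ?U)" by auto
    then have "orbit ?q ` A = orbit ?q ` (A \<inter> ?U) \<union> orbit ?q ` (A - ?U)" by (metis image_Un)
    moreover have "orbit ?q ` (A \<inter> ?U) = {?U}" using inU ab(1) ab_U by auto
    moreover have "orbit ?q ` (A - ?U) = ?R" using other by (intro image_cong) auto
    ultimately show ?thesis by simp
  qed
  have "orbit p a \<noteq> orbit p b" using nb permutation_self_in_orbit[OF pp] by auto
  moreover have "orbit p a \<notin> ?R" "orbit p b \<notin> ?R" "?U \<notin> ?R"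
    using permutation_self_in_orbit[OF pp] by (blast)+
  ultimately show ?thesis unfolding p_im q_im using fin by simp
qed

text \<open>
  Composing with the transposition once more restores \<open>p\<close>, so this is \<open>cycle_count_merge\<close> read backwards.
\<close>

lemma cycle_count_split:
  assumes fin: "finite A" and p: "p permutes A" and ab: "a \<in> A" "b \<in> A"
    and ne: "a \<noteq> b" and b: "b \<in> orbit p a"
  shows "cycle_count (Transposition.transpose a b \<circ> p) A = Suc (cycle_count p A)"
proof -
  let ?q = "Transposition.transpose a b \<circ> p"
  have pp: "permutation p" using fin p by (auto simp: permutation_permutes)
  have qA: "?q permutes A" using p ab by (intro permutes_compose permutes_swap_id)
  have "Transposition.transpose a b \<circ> ?q = p" by (simp add: fun_eq_iff)
  then show ?thesis
    using cycle_count_merge[OF fin qA ab orbit_transpose_split[OF pp ne b]] by simp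
qed

section \<open>Boundary circles of ribbon subgraphs\<close>

definition flip_on :: "'d dessin \<Rightarrow> 'd set set \<Rightarrow> 'd \<Rightarrow> 'd" where
  "flip_on D S d = (if edge_at D d \<in> S then flip D d else d)"

text \<open>
  A dart stands for the point where its edge is attached to the disc of its vertex.  The walk along
  the boundary of the ribbon subgraph with edges \<open>S\<close> follows the disc to the next such point and crosses
  the band there if its edge belongs to \<open>S\<close>.  The points of the absent bands are kept, so that isolated
  discs still have a boundary circle.
\<close>

definition boundary :: "'d dessin \<Rightarrow> 'd set set \<Rightarrow> 'd \<Rightarrow> 'd" where
  "boundary D S = flip_on D S \<circ> rot D"

abbreviation boundary_count :: "'d dessin \<Rightarrow> 'd set set \<Rightarrow> nat" where
  "boundary_count D S \<equiv> cycle_count (boundary D S) (darts D)"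

lemma dessin_finite: "dessin D \<Longrightarrow> finite (darts D)"
  and dessin_rot: "dessin D \<Longrightarrow> rot D permutes darts D"
  and dessin_flip: "dessin D \<Longrightarrow> flip D permutes darts D"
  and dessin_flip_neq: "dessin D \<Longrightarrow> d \<in> darts D \<Longrightarrow> flip D d \<noteq> d"
  unfolding dessin_def by auto

lemma dessin_permutations:
  assumes "dessin D"
  shows "permutation (rot D)" "permutation (flip D)"
  using dessin_finite[OF assms] dessin_rot[OF assms] dessin_flip[OF assms]
  by (auto simp: permutation_permutes)

lemma flip_flip: "dessin D \<Longrightarrow> flip D (flip D d) = d"
  by (metis dessin_def permutes_not_in)

lemma rot_in_darts: "dessin D \<Longrightarrow> rot D d \<in> darts D \<longleftrightarrow> d \<in> darts D"
  and flip_in_darts: "dessin D \<Longrightarrow> flip D d \<in> darts D \<longleftrightarrow> d \<in> darts D"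
  by (simp_all add: dessin_rot dessin_flip permutes_in_image)

lemma edge_at_flip: "dessin D \<Longrightarrow> edge_at D (flip D d) = edge_at D d"
  by (auto simp: edge_at_def flip_flip)

lemma edge_at_eq_iff:
  assumes "dessin D"
  shows "edge_at D d = edge_at D d' \<longleftrightarrow> d' = d \<or> d' = flip D d"
  using flip_flip[OF assms] unfolding edge_at_def by (metis doubleton_eq_iff)

lemma vertex_at_eq_iff:
  assumes "dessin D"
  shows "vertex_at D d = vertex_at D d' \<longleftrightarrow> d \<in> orbit (rot D) d'"
  unfolding vertex_at_def using dessin_permutations(1)[OF assms] by (rule orbit_eq_iff)

lemma vertex_at_rot: "dessin D \<Longrightarrow> vertex_at D (rot D d) = vertex_at D d"
  unfolding vertex_at_def by (simp add: dessin_permutations(1) permutation_orbit_step)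

lemma finite_edges: "dessin D \<Longrightarrow> finite (edges D)"
  by (simp add: dessin_finite edges_def)

lemma finite_vertices: "dessin D \<Longrightarrow> finite (vertices D)"
  by (simp add: dessin_finite vertices_def)

lemma edges_cases:
  assumes "e \<in> edges D"
  obtains d where "d \<in> darts D" "e = edge_at D d"
  using assms unfolding edges_def by auto

lemma flip_on_involution: "dessin D \<Longrightarrow> flip_on D S (flip_on D S d) = d"
  by (auto simp: flip_on_def edge_at_flip flip_flip)

lemma flip_on_permutes:
  assumes "dessin D"
  shows "flip_on D S permutes darts D"
proof (rule bij_imp_permutes)
  show "bij_betw (flip_on D S) (darts D) (darts D)"
    by (rule bij_betwI[where g = "flip_on D S"])
      (use assms in \<open>auto simp: flip_on_involution\<close>, auto simp: flip_on_def flip_in_darts)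
  show "flip_on D S x = x" if "x \<notin> darts D" for x
    using that assms by (auto simp: flip_on_def dessin_def permutes_not_in)
qed

lemma boundary_permutes: "dessin D \<Longrightarrow> boundary D S permutes darts D"
  unfolding boundary_def by (intro permutes_compose dessin_rot flip_on_permutes)

lemma boundary_permutation: "dessin D \<Longrightarrow> permutation (boundary D S)"
  using boundary_permutes dessin_finite by (auto simp: permutation_permutes)

lemma boundary_insert:
  assumes D: "dessin D" and S: "edge_at D d \<notin> S"
  shows "boundary D (insert (edge_at D d) S) =
    Transposition.transpose d (flip D d) \<circ> boundary D S"
proof -
  have "flip_on D (insert (edge_at D d) S) x = Transposition.transpose d (flip D d) (flip_on D S x)"
    for x
  proof (cases "edge_at D x = edge_at D d")
    case True
    then have "x = d \<or> x = flip D d" using edge_at_eq_iff[OF D] by metis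
    moreover have "flip_on D S x = x" using True S by (simp add: flip_on_def)
    ultimately show ?thesis using True
      by (auto simp: flip_on_def flip_flip[OF D] edge_at_flip[OF D])
  next
    case False
    then have "edge_at D (flip_on D S x) \<noteq> edge_at D d"
      by (simp add: flip_on_def edge_at_flip[OF D])
    then have "flip_on D S x \<noteq> d" "flip_on D S x \<noteq> flip D d"
      by (auto simp: edge_at_flip[OF D])
    then show ?thesis using False by (simp add: flip_on_def)
  qed
  then show ?thesis by (auto simp: boundary_def fun_eq_iff)
qed

lemma boundary_count_merge:
  assumes D: "dessin D" and d: "d \<in> darts D" and S: "edge_at D d \<notin> S"
    and "flip D d \<notin> orbit (boundary D S) d"
  shows "boundary_count D S = Suc (boundary_count D (insert (edge_at D d) S))"
  unfolding boundary_insert[OF D S]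
  using assms by (intro cycle_count_merge dessin_finite boundary_permutes) (auto simp: flip_in_darts)

lemma boundary_count_split:
  assumes D: "dessin D" and d: "d \<in> darts D" and S: "edge_at D d \<notin> S"
    and "flip D d \<in> orbit (boundary D S) d"
  shows "boundary_count D (insert (edge_at D d) S) = Suc (boundary_count D S)"
  unfolding boundary_insert[OF D S]
  using assms dessin_flip_neq[OF D d]
  by (intro cycle_count_split dessin_finite boundary_permutes) (auto simp: flip_in_darts)

lemma boundary_count_insert:
  assumes D: "dessin D" and e: "e \<in> edges D" "e \<notin> S"
  shows "boundary_count D S = Suc (boundary_count D (insert e S)) \<or>
    boundary_count D (insert e S) = Suc (boundary_count D S)"
  using boundary_count_merge[OF D] boundary_count_split[OF D] e by (metis edges_cases)

lemma boundary_count_empty: "boundary_count D {} = card (vertices D)"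
proof -
  have "boundary D {} = rot D" by (simp add: boundary_def flip_on_def fun_eq_iff)
  then show ?thesis by (simp add: vertices_def vertex_at_def[abs_def])
qed

lemma finite_subset_edges: "dessin D \<Longrightarrow> S \<subseteq> edges D \<Longrightarrow> finite S"
  using finite_edges finite_subset by blast

text \<open>
  The \<open>card (vertices D)\<close> circles around the isolated discs change in number by exactly one with each
  band.
\<close>

lemma boundary_count_bound:
  assumes D: "dessin D" and S: "S \<subseteq> edges D"
  shows "card (vertices D) \<le> boundary_count D S + card S \<and>
    even (boundary_count D S + card S + card (vertices D))"
  using finite_subset_edges[OF D S] S
proof (induction S rule: finite_induct)
  case empty
  then show ?case by (simp add: boundary_count_empty)
next
  case (insert e S)
  then have "boundary_count D S = Suc (boundary_count D (insert e S)) \<or>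
    boundary_count D (insert e S) = Suc (boundary_count D S)"
    by (intro boundary_count_insert[OF D]) auto
  then show ?case using insert by auto
qed

lemma face_next_permutes: "dessin D \<Longrightarrow> face_next D permutes darts D"
  using permutes_compose[OF dessin_flip permutes_inv[OF dessin_rot], of D]
  by (simp add: face_next_def[abs_def] comp_def)

lemma dual_simps: "darts (dual D) = darts D" "rot (dual D) = face_next D" "flip (dual D) = flip D"
  by (simp_all add: dual_def)

lemma dessin_dual: "dessin D \<Longrightarrow> dessin (dual D)"
  using face_next_permutes[of D] by (simp add: dessin_def dual_simps)

lemma edge_at_dual: "edge_at (dual D) = edge_at D"
  by (simp add: fun_eq_iff edge_at_def dual_simps)

lemma edges_dual: "edges (dual D) = edges D"
  by (simp add: edges_def edge_at_dual dual_simps)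

lemma vertices_dual: "vertices (dual D) = faces D"
  by (auto simp: vertices_def vertex_at_def faces_def dual_simps)

text \<open>
  The surface of the map is cut along this boundary into the ribbon subgraph of \<open>S\<close> and that of the
  complementary edges of the dual, so both have the same boundary, traversed in opposite directions.
\<close>

lemma boundary_count_dual:
  assumes D: "dessin D"
  shows "boundary_count (dual D) (edges D - S) = boundary_count D S"
proof -
  let ?T = "edges D - S"
  let ?b = "boundary D S" and ?b' = "boundary (dual D) ?T"
  have p: "permutation ?b'" using boundary_permutation dessin_dual D by blast
  \<comment> \<open>?g walks along the boundary of the dual subgraph in reverse; crossing the bands of ?T conjugates it
    to the boundary walk of S.\<close>
  let ?g = "\<lambda>x. flip D (rot D (flip_on D ?T x))"
  have b': "?b' x = flip_on D ?T (inv (rot D) (flip D x))" for x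
    by (simp add: boundary_def dual_simps face_next_def flip_on_def edge_at_dual)
  have "?b' (?g x) = x" "?g (?b' x) = x" for x
    using permutes_inverses[OF dessin_rot[OF D]]
    by (simp_all add: b' flip_flip[OF D] flip_on_involution[OF D])
  then have inv: "inv ?b' = ?g"
    by (intro inv_unique_comp) (auto simp: fun_eq_iff)
  have "boundary_count (dual D) ?T = cycle_count ?g (darts D)"
    using orbit_inv_eq[OF p] unfolding inv by (simp add: dual_simps)
  also have "\<dots> = boundary_count D S"
  proof (rule cycle_count_conj[symmetric, where h = "flip_on D ?T"])
    show "permutation ?g" using p inv permutation_inverse by metis
    show "bij_betw (flip_on D ?T) (darts D) (darts D)"
      using flip_on_permutes[OF D] by (rule permutes_imp_bij)
    show "?g x \<in> darts D" if "x \<in> darts D" for x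
      using that by (simp add: flip_in_darts[OF D] rot_in_darts[OF D]
          permutes_in_image[OF flip_on_permutes[OF D]])
    show "flip_on D ?T (?g x) = ?b (flip_on D ?T x)" if "x \<in> darts D" for x
    proof -
      define y where "y = rot D (flip_on D ?T x)"
      have "y \<in> darts D" unfolding y_def using that
        by (simp add: rot_in_darts[OF D] permutes_in_image[OF flip_on_permutes[OF D]])
      then have "edge_at D y \<in> edges D" by (simp add: edges_def)
      then have "flip_on D ?T (flip D y) = flip_on D S y"
        by (simp add: flip_on_def edge_at_flip[OF D] flip_flip[OF D])
      then show ?thesis by (simp add: boundary_def y_def)
    qed
  qed (rule boundary_permutation[OF D])
  finally show ?thesis .
qed

section \<open>Spanning trees and boundary circles\<close>

lemma adjacency_sym: "dessin D \<Longrightarrow> sym (adjacency D T)"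
  unfolding adjacency_def sym_def
  by (auto simp: flip_in_darts) (metis edge_at_flip flip_flip flip_in_darts)

lemma adjacencyI:
  "d \<in> darts D \<Longrightarrow> edge_at D d \<in> T \<Longrightarrow> (vertex_at D d, vertex_at D (flip D d)) \<in> adjacency D T"
  by (auto simp: adjacency_def)

lemma adjacency_mono: "T \<subseteq> T' \<Longrightarrow> adjacency D T \<subseteq> adjacency D T'"
  by (auto simp: adjacency_def)

lemma rtrancl_class_eq_iff:
  assumes "sym R"
  shows "R\<^sup>* `` {x} = R\<^sup>* `` {y} \<longleftrightarrow> (x, y) \<in> R\<^sup>*"
  using sym_rtrancl[OF assms] by (auto dest: symD intro: rtrancl_trans)

lemma quotient_image: "V // R = (\<lambda>x. R `` {x}) ` V"
  by (auto simp: quotient_def)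

text \<open>
  Only the classes of \<open>a\<close> and \<open>b\<close> can be joined, so all classes other than that of \<open>b\<close> stay distinct.
\<close>

lemma card_quotient_insert:
  assumes fin: "finite V" and R: "sym R"
  shows "card (V // R\<^sup>*) \<le> Suc (card (V // (R \<union> {(a, b), (b, a)})\<^sup>*))"
proof -
  let ?R' = "R \<union> {(a, b), (b, a)}"
  have R': "sym ?R'" using R by (auto simp: sym_def)
  have symS: "(x, y) \<in> R\<^sup>* \<longleftrightarrow> (y, x) \<in> R\<^sup>*" for x y using sym_rtrancl[OF R] by (auto dest: symD)
  have conn: "(x, y) \<in> R\<^sup>* \<or> ((x, a) \<in> R\<^sup>* \<or> (x, b) \<in> R\<^sup>*) \<and> ((y, a) \<in> R\<^sup>* \<or> (y, b) \<in> R\<^sup>*)"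
    if "(x, y) \<in> ?R'\<^sup>*" for x y
    using that
  proof induction
    case (step y z)
    then have "(y, z) \<in> R\<^sup>* \<or> (y = a \<or> y = b) \<and> (z = a \<or> z = b)" by auto
    then show ?case
    proof
      assume yz: "(y, z) \<in> R\<^sup>*"
      then have "(z, y) \<in> R\<^sup>*" using symS by blast
      then show ?thesis using step.IH yz by (blast intro: rtrancl_trans)
    next
      assume "(y = a \<or> y = b) \<and> (z = a \<or> z = b)"
      then show ?thesis using step.IH by blast
    qed
  qed simp
  let ?c = "\<lambda>x. R\<^sup>* `` {x}" and ?c' = "\<lambda>x. ?R'\<^sup>* `` {x}"
  define W where "W = {x \<in> V. (x, b) \<notin> R\<^sup>*}"
  have "?c x \<in> insert (?c b) (?c ` W)" if "x \<in> V" for x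
    using that rtrancl_class_eq_iff[OF R, of x b] unfolding W_def by blast
  then have "?c ` V \<subseteq> insert (?c b) (?c ` W)" by blast
  moreover have finW: "finite W" using fin by (simp add: W_def)
  ultimately have "card (?c ` V) \<le> card (insert (?c b) (?c ` W))"
    by (intro card_mono) auto
  also have "\<dots> \<le> Suc (card (?c ` W))" by (rule card_insert_le_m1) auto
  also have "card (?c ` W) \<le> card (?c' ` W)"
  proof (rule card_image_le_kernel[OF finW])
    fix x y assume x: "x \<in> W" and y: "y \<in> W" and "?c' x = ?c' y"
    then have "(x, y) \<in> ?R'\<^sup>*" using rtrancl_class_eq_iff[OF R'] by blast
    moreover have "(x, b) \<notin> R\<^sup>*" "(y, b) \<notin> R\<^sup>*" using x y by (auto simp: W_def)
    ultimately have "(x, y) \<in> R\<^sup>* \<or> (x, a) \<in> R\<^sup>* \<and> (a, y) \<in> R\<^sup>*"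
      using conn[of x y] symS[of y a] by blast
    then have "(x, y) \<in> R\<^sup>*" by (blast intro: rtrancl_trans)
    then show "?c x = ?c y" using rtrancl_class_eq_iff[OF R] by blast
  qed
  also have "\<dots> \<le> card (?c' ` V)" using fin by (intro card_mono) (auto simp: W_def)
  finally show ?thesis by (simp add: quotient_image)
qed

lemma adjacency_insert:
  assumes D: "dessin D" and d: "d \<in> darts D"
  shows "adjacency D (insert (edge_at D d) T) = adjacency D T \<union>
    {(vertex_at D d, vertex_at D (flip D d)), (vertex_at D (flip D d), vertex_at D d)}"
    (is "?L = ?R")
proof
  show "?L \<subseteq> ?R"
  proof
    fix p assume "p \<in> ?L"
    then obtain x where x: "x \<in> darts D" "p = (vertex_at D x, vertex_at D (flip D x))"
      "edge_at D x = edge_at D d \<or> edge_at D x \<in> T" by (auto simp: adjacency_def)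
    then show "p \<in> ?R"
      using edge_at_eq_iff[OF D, of d x] flip_flip[OF D] by (auto simp: adjacency_def)
  qed
  show "?R \<subseteq> ?L"
    using adjacencyI[of d D "insert (edge_at D d) T"] d flip_flip[OF D] flip_in_darts[OF D]
      adjacencyI[of "flip D d" D "insert (edge_at D d) T"] adjacency_mono[of T "insert (edge_at D d) T" D]
    by (auto simp: edge_at_flip[OF D])
qed

lemma graph_components_bound:
  assumes D: "dessin D" and T: "T \<subseteq> edges D"
  shows "card (vertices D) \<le> card (graph_components D T) + card T"
  using finite_subset_edges[OF D T] T
proof (induction T rule: finite_induct)
  case empty
  have "adjacency D {} = {}" by (auto simp: adjacency_def)
  then have "graph_components D {} = (\<lambda>x. {x}) ` vertices D"
    by (simp add: graph_components_def quotient_image)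
  then show ?case by (simp add: card_image)
next
  case (insert e T)
  then obtain d where d: "d \<in> darts D" "e = edge_at D d" by (auto elim: edges_cases)
  have "card (graph_components D T) \<le> Suc (card (graph_components D (insert e T)))"
    unfolding graph_components_def d adjacency_insert[OF D d(1)]
    by (intro card_quotient_insert finite_vertices adjacency_sym D)
  then show ?case using insert by simp
qed

lemma boundary_connected:
  assumes D: "dessin D" and x: "x \<in> darts D" and y: "y \<in> orbit (boundary D T) x"
  shows "(vertex_at D x, vertex_at D y) \<in> (adjacency D T)\<^sup>*"
proof -
  have adj: "(vertex_at D z, vertex_at D (boundary D T z)) \<in> (adjacency D T)\<^sup>*" if "z \<in> darts D" for z
    using adjacencyI[of "rot D z" D T] that
    by (auto simp: boundary_def flip_on_def vertex_at_rot[OF D] rot_in_darts[OF D])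
  show ?thesis using y
  proof induction
    case base
    show ?case using x by (rule adj)
  next
    case (step y)
    have "y \<in> darts D" using permutes_orbit_subset[OF boundary_permutes[OF D] x] step by blast
    then show ?case using step.IH adj[of y] by (blast intro: rtrancl_trans)
  qed
qed

text \<open>
  A boundary circle stays within one connected component.
\<close>

lemma graph_components_le_boundary_count:
  assumes D: "dessin D"
  shows "card (graph_components D T) \<le> boundary_count D T"
proof -
  let ?k = "\<lambda>x. (adjacency D T)\<^sup>* `` {vertex_at D x}"
  have "card (?k ` darts D) \<le> boundary_count D T"
  proof (rule card_image_le_kernel[OF dessin_finite[OF D]])
    fix x y assume x: "x \<in> darts D" and "orbit (boundary D T) x = orbit (boundary D T) y"
    then have "y \<in> orbit (boundary D T) x"
      using orbit_eq_iff[OF boundary_permutation[OF D]] by blast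
    then show "?k x = ?k y"
      using boundary_connected[OF D x] rtrancl_class_eq_iff[OF adjacency_sym[OF D]] by blast
  qed
  then show ?thesis by (simp add: graph_components_def quotient_image vertices_def image_image)
qed

definition forest :: "'d dessin \<Rightarrow> 'd set set \<Rightarrow> bool" where
  "forest D T \<longleftrightarrow> \<not> (\<exists>ds. is_cycle D ds \<and> edge_at D ` set ds \<subseteq> T)"

text \<open>
  Walks along \<open>T\<close> from \<open>x\<close> to \<open>y\<close> that visit no vertex twice, given by their outgoing darts as in
  \<open>is_cycle\<close>.
\<close>

fun simple_path :: "'d dessin \<Rightarrow> 'd set set \<Rightarrow> 'd set \<Rightarrow> 'd list \<Rightarrow> 'd set \<Rightarrow> bool" where
  "simple_path D T x [] y \<longleftrightarrow> x = y"
| "simple_path D T x (d # ds) y \<longleftrightarrow>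
     d \<in> darts D \<and> edge_at D d \<in> T \<and> vertex_at D d = x \<and>
     x \<notin> vertex_at D ` set ds \<and> x \<noteq> y \<and> simple_path D T (vertex_at D (flip D d)) ds y"

lemma simple_path_suffix:
  assumes "simple_path D T z ds y" "x \<in> vertex_at D ` set ds"
  shows "\<exists>ds'. simple_path D T x ds' y"
  using assms
proof (induction ds arbitrary: z)
  case (Cons d ds)
  show ?case
  proof (cases "x = vertex_at D d")
    case True
    then have "simple_path D T x (d # ds) y" using Cons.prems by simp
    then show ?thesis by blast
  next
    case False
    then have "simple_path D T (vertex_at D (flip D d)) ds y" "x \<in> vertex_at D ` set ds"
      using Cons.prems by simp_all
    then show ?thesis by (rule Cons.IH)
  qed
qed simp

lemma simple_path_exists:
  assumes "(x, y) \<in> (adjacency D T)\<^sup>*"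
  shows "\<exists>ds. simple_path D T x ds y"
  using assms
proof (induction rule: converse_rtrancl_induct)
  case base
  show ?case by (intro exI[of _ "[]"]) simp
next
  case (step x z)
  then obtain d ds where d: "d \<in> darts D" "edge_at D d \<in> T" "x = vertex_at D d"
    "z = vertex_at D (flip D d)" and ds: "simple_path D T z ds y" by (auto simp: adjacency_def)
  consider "x = y" | "x \<in> vertex_at D ` set ds" | "x \<noteq> y" "x \<notin> vertex_at D ` set ds" by blast
  then show ?case
  proof cases
    case 1
    then show ?thesis by (intro exI[of _ "[]"]) simp
  next
    case 2
    then show ?thesis using simple_path_suffix[OF ds] by blast
  next
    case 3
    then have "simple_path D T x (d # ds) y" using d ds by simp
    then show ?thesis by blast
  qed
qed

lemma simple_path_next:
  assumes "simple_path D T x ds y" "i < length ds"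
  shows "vertex_at D (flip D (ds ! i)) = (map (vertex_at D) ds @ [y]) ! Suc i"
  using assms
proof (induction ds arbitrary: x i)
  case (Cons d ds)
  show ?case
  proof (cases i)
    case 0
    then show ?thesis using Cons.prems by (cases ds) auto
  next
    case (Suc j)
    then show ?thesis using Cons by auto
  qed
qed simp

text \<open>
  No edge is repeated either: returning along an edge would revisit the vertex that it was left from.
\<close>

lemma simple_path_distinct:
  assumes D: "dessin D" and "simple_path D T x ds y"
  shows "distinct (map (vertex_at D) ds) \<and> y \<notin> vertex_at D ` set ds \<and> set ds \<subseteq> darts D \<and>
    edge_at D ` set ds \<subseteq> T \<and> distinct (map (edge_at D) ds) \<and>
    (ds = [] \<longrightarrow> x = y) \<and> (ds \<noteq> [] \<longrightarrow> vertex_at D (ds ! 0) = x)"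
  using assms(2)
proof (induction ds arbitrary: x)
  case (Cons d ds)
  have "edge_at D d \<noteq> edge_at D d'" if d': "d' \<in> set ds" for d'
  proof
    assume "edge_at D d = edge_at D d'"
    moreover have "d' \<noteq> d" using Cons.prems d' by auto
    ultimately have "d' = flip D d" using edge_at_eq_iff[OF D] by metis
    then have eq: "vertex_at D (flip D d') = x" using flip_flip[OF D] Cons.prems by auto
    obtain i where i: "i < length ds" "d' = ds ! i" using d' by (auto simp: in_set_conv_nth)
    have "simple_path D T (vertex_at D (flip D d)) ds y" using Cons.prems by simp
    from simple_path_next[OF this i(1)] have "x = (map (vertex_at D) ds @ [y]) ! Suc i"
      using eq i by simp
    also have "\<dots> \<in> set (map (vertex_at D) ds @ [y])"
      using i by (intro nth_mem) auto
    finally show False using Cons.prems by auto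
  qed
  moreover have "simple_path D T (vertex_at D (flip D d)) ds y" using Cons.prems by simp
  note Cons.IH[OF this]
  ultimately show ?case using Cons.prems by (simp add: image_iff) blast
qed simp

text \<open>
  A simple path between the ends of the new edge closes up to a cycle.
\<close>

lemma cycle_closing_edge:
  assumes D: "dessin D" and d: "d \<in> darts D" "edge_at D d \<notin> T"
    and conn: "(vertex_at D (flip D d), vertex_at D d) \<in> (adjacency D T)\<^sup>*"
  shows "\<not> forest D (insert (edge_at D d) T)"
proof -
  obtain ds where ds: "simple_path D T (vertex_at D (flip D d)) ds (vertex_at D d)"
    using simple_path_exists[OF conn] by blast
  note dist = simple_path_distinct[OF D ds]
  have "is_cycle D (d # ds)"
    unfolding is_cycle_def
  proof (intro conjI allI impI)
    show "distinct (map (edge_at D) (d # ds))" using dist d by auto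
    show "distinct (map (vertex_at D) (d # ds))" using dist by auto
    show "set (d # ds) \<subseteq> darts D" using dist d by auto
    fix i assume i: "i < length (d # ds)"
    show "vertex_at D (flip D ((d # ds) ! i)) =
      vertex_at D ((d # ds) ! (Suc i mod length (d # ds)))"
    proof (cases i)
      case 0
      then show ?thesis using dist by (cases ds) auto
    next
      case (Suc j)
      then have j: "j < length ds" using i by simp
      show ?thesis
      proof (cases "Suc j = length ds")
        case True
        then have "length ds = Suc j" by simp
        then show ?thesis using simple_path_next[OF ds j] Suc by (simp add: nth_append)
      next
        case False
        then have "Suc j < length ds" using j by simp
        then show ?thesis using simple_path_next[OF ds j] Suc by (simp add: nth_append)
      qed
    qed
  qed simp
  moreover have "edge_at D ` set (d # ds) \<subseteq> insert (edge_at D d) T" using dist by auto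
  ultimately show ?thesis unfolding forest_def by blast
qed

text \<open>
  The ends of the edge removed are still joined by the rest of the cycle.
\<close>

lemma cycle_edge_redundant:
  assumes D: "dessin D" and cyc: "is_cycle D ds" and T: "edge_at D ` set ds \<subseteq> T"
  shows "\<exists>e\<in>T. graph_components D (T - {e}) = graph_components D T"
proof -
  define n where "n = length ds"
  have n: "0 < n" using cyc by (simp add: is_cycle_def n_def)
  have next_v: "vertex_at D (flip D (ds ! i)) = vertex_at D (ds ! (Suc i mod n))" if "i < n" for i
    using cyc that by (simp add: is_cycle_def n_def)
  define d where "d = ds ! 0"
  define T' where "T' = T - {edge_at D d}"
  have dT: "d \<in> darts D" "edge_at D d \<in> T"
    using cyc n T by (auto simp: d_def n_def is_cycle_def)
  have "(vertex_at D (flip D d), vertex_at D (ds ! (Suc i mod n))) \<in> (adjacency D T')\<^sup>*" if "i < n" for i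
    using that
  proof (induction i)
    case 0
    then show ?case using next_v[of 0] by (simp add: d_def)
  next
    case (Suc i)
    let ?x = "ds ! Suc i"
    have x: "?x \<in> set ds" using Suc by (simp add: n_def)
    have "map (edge_at D) ds ! Suc i \<noteq> map (edge_at D) ds ! 0"
      using cyc Suc.prems n nth_eq_iff_index_eq[of "map (edge_at D) ds" "Suc i" 0]
      by (simp add: is_cycle_def n_def)
    then have "edge_at D ?x \<noteq> edge_at D d" using Suc.prems n by (simp add: n_def d_def)
    then have "(vertex_at D ?x, vertex_at D (flip D ?x)) \<in> adjacency D T'"
      using x cyc T by (intro adjacencyI) (auto simp: T'_def is_cycle_def)
    then show ?case using Suc next_v[of "Suc i"] by (simp add: rtrancl.rtrancl_into_rtrancl)
  qed
  from this[of "n - 1"] have conn: "(vertex_at D (flip D d), vertex_at D d) \<in> (adjacency D T')\<^sup>*"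
    using n by (simp add: d_def)
  then have conn': "(vertex_at D d, vertex_at D (flip D d)) \<in> (adjacency D T')\<^sup>*"
    using sym_rtrancl[OF adjacency_sym[OF D]] by (metis symD)
  have "T = insert (edge_at D d) T'" using dT by (auto simp: T'_def)
  then have "adjacency D T = adjacency D T' \<union>
    {(vertex_at D d, vertex_at D (flip D d)), (vertex_at D (flip D d), vertex_at D d)}"
    using adjacency_insert[OF D dT(1), of T'] by simp
  then have "adjacency D T \<subseteq> (adjacency D T')\<^sup>*" "adjacency D T' \<subseteq> adjacency D T"
    using conn conn' by auto
  then have "(adjacency D T')\<^sup>* = (adjacency D T)\<^sup>*"
    by (metis rtrancl_subset)
  then show ?thesis using dT by (auto simp: graph_components_def T'_def intro!: bexI[of _ "edge_at D d"])
qed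

lemma forest_subset: "forest D T \<Longrightarrow> S \<subseteq> T \<Longrightarrow> forest D S"
  unfolding forest_def by blast

text \<open>
  While a forest is built edge by edge, every new edge joins two components.  Its two ends then lie on
  different boundary circles, so the band merges these.
\<close>

lemma forest_boundary_count:
  assumes D: "dessin D" and T: "T \<subseteq> edges D" and "forest D T"
  shows "boundary_count D T + card T = card (vertices D)"
  using finite_subset_edges[OF D T] assms(2,3)
proof (induction T rule: finite_induct)
  case empty
  then show ?case by (simp add: boundary_count_empty)
next
  case (insert e T)
  then obtain d where d: "d \<in> darts D" "e = edge_at D d" by (auto elim: edges_cases)
  have "flip D d \<notin> orbit (boundary D T) d"
  proof
    assume "flip D d \<in> orbit (boundary D T) d"
    then have "(vertex_at D d, vertex_at D (flip D d)) \<in> (adjacency D T)\<^sup>*"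
      by (rule boundary_connected[OF D d(1)])
    then have "(vertex_at D (flip D d), vertex_at D d) \<in> (adjacency D T)\<^sup>*"
      using sym_rtrancl[OF adjacency_sym[OF D]] by (metis symD)
    then show False using cycle_closing_edge[OF D d(1)] insert d by auto
  qed
  then have "boundary_count D T = Suc (boundary_count D (insert e T))"
    using boundary_count_merge[OF D d(1)] insert d by auto
  then show ?case using insert forest_subset[of D "insert e T" T] by auto
qed

text \<open>
  With \<open>k\<close> components, \<open>b\<close> boundary circles and \<open>v\<close> vertices, always \<open>v - card T \<le> k \<le> b\<close>.  For
  a forest \<open>b = v - card T\<close>, so a spanning tree has \<open>b = k = 1\<close>.  Conversely, if \<open>b = 1 = v - card T\<close>,
  then \<open>k = 1\<close>, and an edge on a cycle could be deleted without disconnecting the graph, against the first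
  inequality.
\<close>

theorem spanning_tree_iff_boundary_count:
  assumes D: "dessin D" and ne: "darts D \<noteq> {}"
  shows "T \<in> spanning_trees D \<longleftrightarrow>
    T \<subseteq> edges D \<and> boundary_count D T = 1 \<and> Suc (card T) = card (vertices D)"
proof -
  have *: "T \<in> spanning_trees D \<longleftrightarrow>
    T \<subseteq> edges D \<and> card (graph_components D T) = 1 \<and> forest D T"
    by (simp add: spanning_trees_def forest_def)
  have fin: "finite (graph_components D S)" for S
    using finite_vertices[OF D] by (simp add: graph_components_def quotient_image)
  have "graph_components D T \<noteq> {}"
    using ne by (simp add: graph_components_def quotient_image vertices_def)
  then have pos: "0 < card (graph_components D T)" using fin by (simp add: card_gt_0_iff)
  show ?thesis
  proof
    assume "T \<in> spanning_trees D"
    then have T: "T \<subseteq> edges D" "card (graph_components D T) = 1" "forest D T" using * by auto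
    have "boundary_count D T = 1" "Suc (card T) = card (vertices D)"
      using forest_boundary_count[OF D T(1,3)] graph_components_bound[OF D T(1)]
        graph_components_le_boundary_count[OF D, of T] T(2) by linarith+
    then show "T \<subseteq> edges D \<and> boundary_count D T = 1 \<and> Suc (card T) = card (vertices D)"
      using T(1) by blast
  next
    assume R: "T \<subseteq> edges D \<and> boundary_count D T = 1 \<and> Suc (card T) = card (vertices D)"
    then have k: "card (graph_components D T) = 1"
      using graph_components_le_boundary_count[OF D, of T] pos by linarith
    have "forest D T"
    proof (rule ccontr)
      assume "\<not> forest D T"
      then obtain ds where ds: "is_cycle D ds" "edge_at D ` set ds \<subseteq> T"
        unfolding forest_def by blast
      obtain e where e: "e \<in> T" "graph_components D (T - {e}) = graph_components D T"
        using cycle_edge_redundant[OF D ds] by blast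
      have "card (vertices D) \<le> card (graph_components D (T - {e})) + card (T - {e})"
        using R by (intro graph_components_bound[OF D]) auto
      moreover have "Suc (card (T - {e})) = card T"
        using e finite_subset_edges[OF D] R by (blast intro: card_Suc_Diff1)
      moreover have "Suc (card T) = card (vertices D)" using R by blast
      ultimately show False using k unfolding e(2) by linarith
    qed
    then show "T \<in> spanning_trees D" using * R k by blast
  qed
qed

lemma graph_components_antimono:
  assumes D: "dessin D" and "T \<subseteq> T'" 
  shows "card (graph_components D T') \<le> card (graph_components D T)"
proof -
  let ?R = "adjacency D T" and ?R' = "adjacency D T'"
  have sub: "?R\<^sup>* \<subseteq> ?R'\<^sup>*" using adjacency_mono[OF assms(2)] by (rule rtrancl_mono)
  have "card ((\<lambda>x. ?R'\<^sup>* `` {x}) ` vertices D) \<le> card ((\<lambda>x. ?R\<^sup>* `` {x}) ` vertices D)"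
  proof (rule card_image_le_kernel[OF finite_vertices[OF D]])
    fix x y assume "?R\<^sup>* `` {x} = ?R\<^sup>* `` {y}"
    then have "(x, y) \<in> ?R'\<^sup>*" using sub by blast
    then show "?R'\<^sup>* `` {x} = ?R'\<^sup>* `` {y}"
      using rtrancl_class_eq_iff[OF adjacency_sym[OF D]] by blast
  qed
  then show ?thesis by (simp add: graph_components_def quotient_image)
qed

text \<open>
  The lower bound and the parity come from \<open>boundary_count_bound\<close> for \<open>S\<close>; the upper bound is the lower
  bound for the complementary edges in the dual, since \<open>e = v + f\<close> in genus one.  The dessin is connected
  because its subgraph \<open>S\<close> already is.
\<close>

theorem genus_one_one_boundary:
  assumes D: "dessin D" and ne: "darts D \<noteq> {}" and g: "genus D = 1"
    and S: "S \<subseteq> edges D" and b: "boundary_count D S = 1"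
  shows "Suc (card S) = card (vertices D) \<or> card S = Suc (card (vertices D))"
    and "card (edges D - S) + card S = card (edges D)"
    and "Suc (card (edges D - S)) = card (faces D) \<longleftrightarrow> card S = Suc (card (vertices D))"
proof -
  have fin: "finite (graph_components D S)" for S
    using finite_vertices[OF D] by (simp add: graph_components_def quotient_image)
  have "graph_components D (edges D) \<noteq> {}"
    using ne by (simp add: graph_components_def quotient_image vertices_def)
  then have "0 < card (graph_components D (edges D))" using fin by (simp add: card_gt_0_iff)
  then have k: "card (graph_components D (edges D)) = 1"
    using graph_components_antimono[OF D S] graph_components_le_boundary_count[OF D, of S] b by simp
  have ev: "card (edges D) = card (vertices D) + card (faces D)"
    using g k unfolding genus_def by (simp add: field_simps flip: of_nat_add)
  show card: "card (edges D - S) + card S = card (edges D)"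
    using card_Diff_subset[OF finite_subset_edges[OF D S] S] card_mono[OF finite_edges[OF D] S] by simp
  have "card (faces D) \<le> 1 + card (edges D - S)"
    using boundary_count_bound[OF dessin_dual[OF D], of "edges D - S"]
    by (simp add: edges_dual vertices_dual boundary_count_dual[OF D] b)
  then have up: "card S \<le> Suc (card (vertices D))" using card ev by simp
  have lo: "card (vertices D) \<le> Suc (card S)" and par: "even (Suc (card S) + card (vertices D))"
    using boundary_count_bound[OF D S] b by auto
  then show "Suc (card S) = card (vertices D) \<or> card S = Suc (card (vertices D))"
    using up by presburger
  show "Suc (card (edges D - S)) = card (faces D) \<longleftrightarrow> card S = Suc (card (vertices D))"
    using card ev by auto
qed

section \<open>Cycles on a plane map bound\<close>

abbreviation sdiff :: "'a set \<Rightarrow> 'a set \<Rightarrow> 'a set" where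
  "sdiff A B \<equiv> (A - B) \<union> (B - A)"

lemma even_card_sdiff:
  assumes "finite A" "finite B"
  shows "even (card (sdiff A B)) \<longleftrightarrow> (even (card A) \<longleftrightarrow> even (card B))"
proof -
  have "card (sdiff A B) = card (A - B) + card (B - A)"
    using assms by (intro card_Un_disjoint) auto
  moreover have "card A = card (A - B) + card (A \<inter> B)" "card B = card (B - A) + card (A \<inter> B)"
    using assms by (simp_all add: card_Diff_subset_Int Int_commute card_mono)
  ultimately show ?thesis by presburger
qed

text \<open>
  Rank and nullity over \<open>\<int>/2\<close>: all nonempty fibres of a homomorphism are translates of its kernel.  Vector
  spaces appear as families of sets under symmetric difference.
\<close>

lemma card_sdiff_homomorphism:
  assumes fin: "finite Y"
    and closed: "\<And>A B. A \<in> Y \<Longrightarrow> B \<in> Y \<Longrightarrow> sdiff A B \<in> Y"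
    and hom: "\<And>A B. A \<in> Y \<Longrightarrow> B \<in> Y \<Longrightarrow> h (sdiff A B) = sdiff (h A) (h B)"
  shows "card Y = card (h ` Y) * card {A \<in> Y. h A = {}}"
proof -
  have fibre: "card {A \<in> Y. h A = z} = card {A \<in> Y. h A = {}}" if "z \<in> h ` Y" for z
  proof -
    obtain B where B: "B \<in> Y" "z = h B" using \<open>z \<in> h ` Y\<close> by auto
    have "bij_betw (sdiff B) {A \<in> Y. h A = z} {A \<in> Y. h A = {}}"
    proof (rule bij_betwI[where g = "sdiff B"])
      show "sdiff B \<in> {A \<in> Y. h A = z} \<rightarrow> {A \<in> Y. h A = {}}"
        using closed[OF B(1)] hom[OF B(1)] B(2) by auto
      show "sdiff B \<in> {A \<in> Y. h A = {}} \<rightarrow> {A \<in> Y. h A = z}"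
        using closed[OF B(1)] hom[OF B(1)] B(2) by auto
      show "sdiff B (sdiff B A) = A" for A by blast
      then show "sdiff B (sdiff B A) = A" for A .
    qed
    then show ?thesis by (rule bij_betw_same_card)
  qed
  have "card Y = (\<Sum>A\<in>Y. 1)" by simp
  also have "\<dots> = (\<Sum>z\<in>h ` Y. \<Sum>A\<in>{A \<in> Y. h A = z}. 1)" by (rule sum.image_gen[OF fin])
  also have "\<dots> = (\<Sum>z\<in>h ` Y. card {A \<in> Y. h A = {}})"
    using fibre by (intro sum.cong) auto
  finally show ?thesis by simp
qed

text \<open>
  The unions of \<open>p\<close>-cycles.  For \<open>flip\<close> and \<open>face_next\<close> these are the sets of edges and the sets of
  faces of a map, that is, its cochains with coefficients in \<open>\<int>/2\<close>, represented by sets of darts.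
\<close>

definition invariant_sets :: "('a \<Rightarrow> 'a) \<Rightarrow> 'a set \<Rightarrow> 'a set set" where
  "invariant_sets p A = {U. U \<subseteq> A \<and> (\<forall>x\<in>A. p x \<in> U \<longleftrightarrow> x \<in> U)}"

lemma card_invariant_sets:
  assumes fin: "finite A" and p: "p permutes A"
  shows "card (invariant_sets p A) = 2 ^ cycle_count p A"
proof -
  let ?Q = "orbit p ` A"
  have pp: "permutation p" using fin p by (auto simp: permutation_permutes)
  have "invariant_sets p A = Union ` Pow ?Q"
  proof (intro equalityI subsetI)
    fix U assume U: "U \<in> invariant_sets p A"
    have "x \<in> orbit p x \<and> orbit p x \<subseteq> U" if "x \<in> U" for x
    proof
      show "x \<in> orbit p x" using pp by (rule permutation_self_in_orbit)
      show "orbit p x \<subseteq> U"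
        using that by (rule orbit_subset_closed) (use U in \<open>auto simp: invariant_sets_def\<close>)
    qed
    then have "U = \<Union> (orbit p ` U)" by blast
    moreover have "orbit p ` U \<in> Pow ?Q" using U by (auto simp: invariant_sets_def)
    ultimately show "U \<in> Union ` Pow ?Q" by blast
  next
    fix U assume "U \<in> Union ` Pow ?Q"
    then obtain B where B: "B \<subseteq> A" "U = \<Union> (orbit p ` B)" by (auto simp: subset_image_iff)
    have "U \<subseteq> A" using B permutes_orbit_subset[OF p] by blast
    moreover have "p x \<in> U \<longleftrightarrow> x \<in> U" for x
      unfolding B(2) by (simp add: orbit_closed_permutation[OF pp])
    ultimately show "U \<in> invariant_sets p A" by (simp add: invariant_sets_def)
  qed
  moreover have "inj_on Union (Pow ?Q)"
  proof (rule inj_onI)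
    have *: "K \<in> Q'" if "K \<in> Q" "Q \<subseteq> ?Q" "Q' \<subseteq> ?Q" "\<Union> Q = \<Union> Q'" for K Q Q'
    proof -
      obtain x where x: "K = orbit p x" using \<open>K \<in> Q\<close> \<open>Q \<subseteq> ?Q\<close> by auto
      then have "x \<in> \<Union> Q'" using that permutation_self_in_orbit[OF pp, of x] by blast
      then obtain y where y: "orbit p y \<in> Q'" "x \<in> orbit p y" using \<open>Q' \<subseteq> ?Q\<close> by blast
      then show "K \<in> Q'" using x orbit_eq_iff[OF pp, of x y] by simp
    qed
    fix Q Q' assume Q: "Q \<in> Pow ?Q" "Q' \<in> Pow ?Q" "\<Union> Q = \<Union> Q'"
    show "Q = Q'"
    proof (intro equalityI subsetI)
      show "K \<in> Q'" if "K \<in> Q" for K using *[OF that] Q by simp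
      show "K \<in> Q" if "K \<in> Q'" for K using *[OF that] Q by simp
    qed
  qed
  ultimately show ?thesis using fin by (simp add: card_image card_Pow)
qed

lemma invariant_sets_sdiff:
  "U \<in> invariant_sets p A \<Longrightarrow> U' \<in> invariant_sets p A \<Longrightarrow> sdiff U U' \<in> invariant_sets p A"
  by (auto simp: invariant_sets_def)

lemma cycle_count_flip:
  assumes D: "dessin D"
  shows "cycle_count (flip D) (darts D) = card (edges D)"
proof -
  have "orbit (flip D) d = edge_at D d" for d
  proof
    show "orbit (flip D) d \<subseteq> edge_at D d"
      by (rule orbit_subset_closed) (auto simp: edge_at_def flip_flip[OF D])
    show "edge_at D d \<subseteq> orbit (flip D) d"
      using permutation_self_in_orbit[OF dessin_permutations(2)[OF D], of d] orbit.base[of "flip D" d]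
      by (auto simp: edge_at_def)
  qed
  then show ?thesis by (simp add: edges_def)
qed

lemma connected_invariant_set:
  assumes D: "dessin D" and conn: "card (graph_components D (edges D)) = 1"
    and U: "U \<in> invariant_sets (rot D) (darts D)" "U \<in> invariant_sets (flip D) (darts D)"
  shows "U = {} \<or> U = darts D"
proof (rule disjCI)
  assume "U \<noteq> darts D"
  show "U = {}"
  proof (rule ccontr)
    assume "U \<noteq> {}"
    then obtain x where x: "x \<in> U" by blast
    have sub: "U \<subseteq> darts D" using U by (simp add: invariant_sets_def)
    have rotU: "orbit (rot D) u \<subseteq> U" if "u \<in> U" for u
      using that by (rule orbit_subset_closed) (use U(1) sub in \<open>auto simp: invariant_sets_def\<close>)
    have reach: "z \<subseteq> U" if "(vertex_at D x, z) \<in> (adjacency D (edges D))\<^sup>*" for z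
      using that
    proof induction
      case base
      show ?case using rotU[OF x] by (simp add: vertex_at_def)
    next
      case (step y z)
      then obtain d where d: "d \<in> darts D" "y = vertex_at D d" "z = vertex_at D (flip D d)"
        by (auto simp: adjacency_def)
      have "d \<in> U"
        using step.IH d permutation_self_in_orbit[OF dessin_permutations(1)[OF D], of d]
        by (auto simp: vertex_at_def)
      then have "flip D d \<in> U" using U(2) d by (simp add: invariant_sets_def)
      then show ?case using rotU d by (simp add: vertex_at_def)
    qed
    have "y \<in> U" if "y \<in> darts D" for y
    proof -
      let ?c = "\<lambda>x. (adjacency D (edges D))\<^sup>* `` {vertex_at D x}"
      have "?c x \<in> graph_components D (edges D)" "?c y \<in> graph_components D (edges D)"
        using that x sub by (auto simp: graph_components_def quotient_image vertices_def)
      then have "?c x = ?c y" using conn by (metis card_1_singletonE singletonD)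
      then have "(vertex_at D x, vertex_at D y) \<in> (adjacency D (edges D))\<^sup>*" by blast
      then have "vertex_at D y \<subseteq> U" by (rule reach)
      then show ?thesis
        using permutation_self_in_orbit[OF dessin_permutations(1)[OF D], of y]
        by (auto simp: vertex_at_def)
    qed
    then show False using sub \<open>U \<noteq> darts D\<close> by blast
  qed
qed

lemma vertex_subset_darts: "dessin D \<Longrightarrow> x \<in> vertices D \<Longrightarrow> x \<subseteq> darts D"
  using permutes_orbit_subset[OF dessin_rot, of D] unfolding vertices_def vertex_at_def by blast

lemma finite_vertex: "dessin D \<Longrightarrow> x \<in> vertices D \<Longrightarrow> finite x"
  using vertex_subset_darts dessin_finite finite_subset by blast

lemma in_vertex_iff: "dessin D \<Longrightarrow> x \<in> vertices D \<Longrightarrow> d \<in> x \<longleftrightarrow> vertex_at D d = x"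
  using vertex_at_eq_iff[of D d] by (auto simp: vertices_def vertex_at_def)

text \<open>
  The edges with exactly one of their two sides in \<open>U\<close>.
\<close>

definition coboundary :: "'d dessin \<Rightarrow> 'd set \<Rightarrow> 'd set" where
  "coboundary D U = {d \<in> darts D. (d \<in> U) \<noteq> (flip D d \<in> U)}"

text \<open>
  The boundary modulo two of the set of edges represented by \<open>c\<close>.
\<close>

definition odd_vertices :: "'d dessin \<Rightarrow> 'd set \<Rightarrow> 'd set set" where
  "odd_vertices D c = {x \<in> vertices D. odd (card (x \<inter> c))}"

lemma coboundary_sdiff: "coboundary D (sdiff U U') = sdiff (coboundary D U) (coboundary D U')"
  by (auto simp: coboundary_def)

lemma odd_vertices_sdiff:
  assumes "dessin D"
  shows "odd_vertices D (sdiff c c') = sdiff (odd_vertices D c) (odd_vertices D c')"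
proof -
  have "even (card (x \<inter> sdiff c c')) \<longleftrightarrow> (even (card (x \<inter> c)) \<longleftrightarrow> even (card (x \<inter> c')))"
    if "x \<in> vertices D" for x
  proof -
    have "x \<inter> sdiff c c' = sdiff (x \<inter> c) (x \<inter> c')" by blast
    then show ?thesis using finite_vertex[OF assms that] by (simp add: even_card_sdiff)
  qed
  then show ?thesis by (auto simp: odd_vertices_def)
qed

text \<open>
  A turn around a vertex enters \<open>U\<close> as often as it leaves it.
\<close>

lemma odd_vertices_coboundary:
  assumes D: "dessin D" and U: "U \<in> invariant_sets (face_next D) (darts D)"
  shows "odd_vertices D (coboundary D U) = {}"
proof -
  have "even (card (x \<inter> coboundary D U))" if x: "x \<in> vertices D" for x
  proof -
    have rot_flip: "flip D (rot D d) \<in> U \<longleftrightarrow> d \<in> U" if "d \<in> darts D" for d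
    proof -
      have "face_next D (flip D (rot D d)) = d"
        using permutes_inverses(2)[OF dessin_rot[OF D]] by (simp add: face_next_def flip_flip[OF D])
      then show ?thesis
        using U that flip_in_darts[OF D] rot_in_darts[OF D] unfolding invariant_sets_def
        by (metis (mono_tags, lifting) mem_Collect_eq)
    qed
    \<comment> \<open>The right side of a dart lies in the face of the corner before it, so membership of the right side
      in U is membership of the preceding dart.\<close>
    have eq: "x \<inter> coboundary D U = sdiff (x \<inter> U) (rot D ` (x \<inter> U))"
    proof -
      have "d \<in> x \<inter> coboundary D U \<longleftrightarrow> d \<in> sdiff (x \<inter> U) (rot D ` (x \<inter> U))" for d
      proof -
        define c where "c = inv (rot D) d"
        have d: "d = rot D c" unfolding c_def using permutes_inverses(1)[OF dessin_rot[OF D]] by simp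
        have "rot D c \<in> rot D ` (x \<inter> U) \<longleftrightarrow> c \<in> x \<inter> U"
          using permutes_inj[OF dessin_rot[OF D]] by (auto dest: injD)
        moreover have "rot D c \<in> x \<longleftrightarrow> c \<in> x"
          using in_vertex_iff[OF D x] vertex_at_rot[OF D] by simp
        moreover have "c \<in> darts D" if "c \<in> x" using that vertex_subset_darts[OF D x] by auto
        ultimately show ?thesis
          using rot_flip[of c] rot_in_darts[OF D, of c] unfolding d coboundary_def by blast
      qed
      then show ?thesis by blast
    qed
    have "card (rot D ` (x \<inter> U)) = card (x \<inter> U)"
      using permutes_inj[OF dessin_rot[OF D]] by (intro card_image) (auto simp: inj_on_def)
    then show ?thesis unfolding eq using finite_vertex[OF D x]
      by (subst even_card_sdiff) auto
  qed
  then show ?thesis by (auto simp: odd_vertices_def)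
qed

lemma odd_vertices_edge:
  assumes D: "dessin D" and d: "d \<in> darts D"
  shows "odd_vertices D (edge_at D d) = sdiff {vertex_at D d} {vertex_at D (flip D d)}"
proof -
  have v: "vertex_at D d \<in> vertices D" "vertex_at D (flip D d) \<in> vertices D"
    using d flip_in_darts[OF D] by (auto simp: vertices_def)
  have "odd (card (x \<inter> edge_at D d)) \<longleftrightarrow> (x = vertex_at D d) \<noteq> (x = vertex_at D (flip D d))"
    if x: "x \<in> vertices D" for x
  proof -
    have "x \<inter> edge_at D d = (if d \<in> x then {d} else {}) \<union> (if flip D d \<in> x then {flip D d} else {})"
      by (auto simp: edge_at_def)
    then have "odd (card (x \<inter> edge_at D d)) \<longleftrightarrow> (d \<in> x) \<noteq> (flip D d \<in> x)"
      using dessin_flip_neq[OF D d] by auto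
    then show ?thesis using in_vertex_iff[OF D x] by auto
  qed
  then show ?thesis using v by (auto simp: odd_vertices_def)
qed

text \<open>
  In a connected graph, a path from \<open>x0\<close> to \<open>x\<close> has these two vertices as its boundary; sums of such
  paths realise every set of vertices up to \<open>x0\<close>.
\<close>

lemma card_odd_vertices_image:
  assumes D: "dessin D" and conn: "card (graph_components D (edges D)) = 1"
  shows "2 ^ (card (vertices D) - 1) \<le> card (odd_vertices D ` invariant_sets (flip D) (darts D))"
proof -
  let ?Y = "invariant_sets (flip D) (darts D)"
  have "graph_components D (edges D) \<noteq> {}" using conn by auto
  then obtain d0 where d0: "d0 \<in> darts D"
    by (auto simp: graph_components_def quotient_image vertices_def)
  define x0 where "x0 = vertex_at D d0"
  have x0: "x0 \<in> vertices D" using d0 by (simp add: x0_def vertices_def)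
  have path: "\<exists>c\<in>?Y. odd_vertices D c = sdiff {x} {x0}" if "(x0, x) \<in> (adjacency D (edges D))\<^sup>*" for x
    using that
  proof induction
    case base
    show ?case by (intro bexI[of _ "{}"]) (auto simp: odd_vertices_def invariant_sets_def)
  next
    case (step y z)
    then obtain d c where d: "d \<in> darts D" "y = vertex_at D d" "z = vertex_at D (flip D d)"
      and c: "c \<in> ?Y" "odd_vertices D c = sdiff {y} {x0}" by (auto simp: adjacency_def)
    have "edge_at D d \<in> ?Y"
      using d flip_in_darts[OF D] flip_flip[OF D] unfolding invariant_sets_def edge_at_def
      by (auto) (metis flip_flip[OF D])
    then have "sdiff c (edge_at D d) \<in> ?Y" using c by (intro invariant_sets_sdiff)
    moreover have "odd_vertices D (sdiff c (edge_at D d)) = sdiff {z} {x0}"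
      unfolding odd_vertices_sdiff[OF D] odd_vertices_edge[OF D d(1)] c(2) d(2,3) by blast
    ultimately show ?case by blast
  qed
  have all: "\<exists>c\<in>?Y. odd_vertices D c = sdiff {x} {x0}" if x: "x \<in> vertices D" for x
  proof (rule path)
    let ?c = "\<lambda>x. (adjacency D (edges D))\<^sup>* `` {x}"
    have "?c x0 \<in> graph_components D (edges D)" "?c x \<in> graph_components D (edges D)"
      using x x0 by (auto simp: graph_components_def quotient_image)
    then have "?c x0 = ?c x" using conn by (metis card_1_singletonE singletonD)
    then show "(x0, x) \<in> (adjacency D (edges D))\<^sup>*" by blast
  qed
  have "\<exists>c\<in>?Y. odd_vertices D c - {x0} = W" if "W \<subseteq> vertices D - {x0}" for W
  proof -
    have "finite W" using that finite_vertices[OF D] finite_subset by blast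
    then show ?thesis using that
    proof (induction W rule: finite_induct)
      case empty
      show ?case by (intro bexI[of _ "{}"]) (auto simp: odd_vertices_def invariant_sets_def)
    next
      case (insert x W)
      then obtain c where c: "c \<in> ?Y" "odd_vertices D c - {x0} = W" by auto
      obtain c' where c': "c' \<in> ?Y" "odd_vertices D c' = sdiff {x} {x0}"
        using all insert.prems by blast
      have "sdiff c c' \<in> ?Y" using c c' by (intro invariant_sets_sdiff)
      moreover have "odd_vertices D (sdiff c c') - {x0} = insert x W"
        unfolding odd_vertices_sdiff[OF D] c'(2) using c(2) insert.hyps insert.prems by blast
      ultimately show ?case by blast
    qed
  qed
  note ex = this
  have "Pow (vertices D - {x0}) \<subseteq> (\<lambda>Z. Z - {x0}) ` odd_vertices D ` ?Y"
  proof
    fix W assume "W \<in> Pow (vertices D - {x0})"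
    then obtain c where "c \<in> ?Y" "odd_vertices D c - {x0} = W" using ex[of W] by auto
    then show "W \<in> (\<lambda>Z. Z - {x0}) ` odd_vertices D ` ?Y" by (metis imageI)
  qed
  moreover have fin: "finite (odd_vertices D ` ?Y)"
    using dessin_finite[OF D] by (auto simp: invariant_sets_def)
  ultimately have "card (Pow (vertices D - {x0})) \<le> card ((\<lambda>Z. Z - {x0}) ` odd_vertices D ` ?Y)"
    by (intro card_mono) auto
  also have "\<dots> \<le> card (odd_vertices D ` ?Y)" using fin by (rule card_image_le)
  finally show ?thesis using x0 finite_vertices[OF D] by (simp add: card_Pow)
qed

text \<open>
  Let \<open>v\<close>, \<open>e\<close>, \<open>f\<close> count vertices, edges and faces.  The coboundaries number \<open>2 ^ (f - 1)\<close>, because only the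
  empty and the full set of faces have coboundary zero.  The boundary map has at least \<open>2 ^ (v - 1)\<close> values, so at
  most \<open>2 ^ (e - v + 1)\<close> sets of edges are cycles.  Euler's formula makes the two numbers equal, and every
  coboundary is a cycle.
\<close>

theorem planar_cycle_is_coboundary:
  assumes D: "dessin D" and conn: "card (graph_components D (edges D)) = 1" and g: "genus D = 0"
    and c: "c \<in> invariant_sets (flip D) (darts D)" "odd_vertices D c = {}"
  obtains U where "U \<in> invariant_sets (face_next D) (darts D)" "c = coboundary D U"
proof -
  let ?X = "invariant_sets (face_next D) (darts D)" and ?Y = "invariant_sets (flip D) (darts D)"
  let ?K = "{c \<in> ?Y. odd_vertices D c = {}}"
  note fin = dessin_finite[OF D]
  have finX: "finite ?X" and finY: "finite ?Y" using fin by (auto simp: invariant_sets_def)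
  have euler: "card (edges D) + 2 = card (vertices D) + card (faces D)"
  proof -
    have "real (card (edges D)) + 2 = real (card (vertices D)) + real (card (faces D))"
      using g unfolding genus_def conn by simp
    then show ?thesis by linarith
  qed
  have "graph_components D (edges D) \<noteq> {}" using conn by auto
  then have ne: "darts D \<noteq> {}" by (auto simp: graph_components_def quotient_image vertices_def)
  then have v: "0 < card (vertices D)" and f: "0 < card (faces D)"
    using fin by (auto simp: card_gt_0_iff vertices_def faces_def)
  have ker: "{U \<in> ?X. coboundary D U = {}} = {{}, darts D}"
  proof (intro equalityI subsetI)
    fix U assume "U \<in> {U \<in> ?X. coboundary D U = {}}"
    then have U: "U \<in> ?X" and flipU: "\<And>d. d \<in> darts D \<Longrightarrow> flip D d \<in> U \<longleftrightarrow> d \<in> U"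
      by (auto simp: coboundary_def)
    have "rot D d \<in> U \<longleftrightarrow> d \<in> U" if d: "d \<in> darts D" for d
    proof -
      have "face_next D (flip D (rot D d)) = d"
        using permutes_inverses(2)[OF dessin_rot[OF D]] by (simp add: face_next_def flip_flip[OF D])
      then have "d \<in> U \<longleftrightarrow> flip D (rot D d) \<in> U"
        using U d flip_in_darts[OF D] rot_in_darts[OF D] unfolding invariant_sets_def
        by (metis (mono_tags, lifting) mem_Collect_eq)
      then show ?thesis using flipU d rot_in_darts[OF D] by blast
    qed
    then have "U = {} \<or> U = darts D"
      using U flipU by (intro connected_invariant_set[OF D conn]) (auto simp: invariant_sets_def)
    then show "U \<in> {{}, darts D}" by auto
  next
    fix U assume "U \<in> {{}, darts D}"
    then show "U \<in> {U \<in> ?X. coboundary D U = {}}"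
      using flip_in_darts[OF D] permutes_in_image[OF face_next_permutes[OF D]]
      by (auto simp: invariant_sets_def coboundary_def)
  qed
  have "card ?X = card (coboundary D ` ?X) * card {U \<in> ?X. coboundary D U = {}}"
    using finX by (rule card_sdiff_homomorphism) (simp_all add: invariant_sets_sdiff coboundary_sdiff)
  then have X: "2 ^ card (faces D) = card (coboundary D ` ?X) * 2"
    using card_invariant_sets[OF fin face_next_permutes[OF D]] ker ne by (simp add: faces_def)
  have "card ?Y = card (odd_vertices D ` ?Y) * card ?K"
    using finY by (rule card_sdiff_homomorphism) (simp_all add: invariant_sets_sdiff odd_vertices_sdiff[OF D])
  then have Y: "2 ^ card (edges D) = card (odd_vertices D ` ?Y) * card ?K"
    using card_invariant_sets[OF fin dessin_flip[OF D]] cycle_count_flip[OF D] by simp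
  have "2 ^ (card (vertices D) - 1) * card ?K \<le> 2 ^ card (edges D)"
    unfolding Y using card_odd_vertices_image[OF D conn] by (rule mult_right_mono) simp
  also have "card (edges D) = (card (vertices D) - 1) + (card (faces D) - 1)"
    using euler v f by simp
  finally have "card ?K \<le> 2 ^ (card (faces D) - 1)" by (simp add: power_add)
  also have "\<dots> = card (coboundary D ` ?X)"
    using X f by (cases "card (faces D)") auto
  finally have le: "card ?K \<le> card (coboundary D ` ?X)" .
  have "coboundary D U \<in> ?Y" for U
    using flip_in_darts[OF D] flip_flip[OF D] by (auto simp: coboundary_def invariant_sets_def)
  then have "coboundary D ` ?X \<subseteq> ?K" using odd_vertices_coboundary[OF D] by auto
  then have "coboundary D ` ?X = ?K" using le finY by (intro card_seteq) auto
  then have "c \<in> coboundary D ` ?X" using c by simp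
  then show thesis using that by blast
qed

section \<open>Sides of the all-A circles\<close>

text \<open>
  The letters \<open>r\<close> and \<open>fl\<close> abbreviate the rotation at the crossings and the exchange of the two ends
  of an edge of the diagram.
\<close>

locale plane_link_diagram =
  fixes P :: "'d link_diagram"
  assumes connected_diagram: "connected_link_diagram P"
begin

abbreviation "G \<equiv> shadow P"
abbreviation "r \<equiv> rot (shadow P)"
abbreviation "fl \<equiv> flip (shadow P)"

lemma dessin_shadow: "dessin G"
  and shadow_connected: "card (graph_components G (edges G)) = 1"
  and shadow_planar: "genus G = 0"
  and outer_face: "outer P \<in> faces G"
  and four_valent: "x \<in> vertices G \<Longrightarrow> card x = 4"
  and over_darts: "over P \<subseteq> darts G"
  and over_rot: "d \<in> darts G \<Longrightarrow> r d \<in> over P \<longleftrightarrow> d \<notin> over P"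
  using connected_diagram by (simp_all add: connected_link_diagram_def Let_def)

lemmas r_darts [simp] = rot_in_darts[OF dessin_shadow]
  and fl_darts [simp] = flip_in_darts[OF dessin_shadow]
  and fl_fl [simp] = flip_flip[OF dessin_shadow]

lemma r_inj [simp]: "r x = r y \<longleftrightarrow> x = y"
  using permutes_inj[OF dessin_rot[OF dessin_shadow]] by (auto dest: injD)

text \<open>
  Four darts meet at a crossing; as over and under alternate, only \<open>r (r d) = d\<close> has to be excluded, and that
  would leave two darts.
\<close>

lemma rot_four_distinct:
  assumes d: "d \<in> darts G"
  shows "distinct [d, r d, r (r d), r (r (r d))]" and "r (r (r (r d))) = d"
    and "vertex_at G d = {d, r d, r (r d), r (r (r d))}"
proof -
  let ?O = "vertex_at G d"
  have card: "card ?O = 4" using d by (intro four_valent) (simp add: vertices_def)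
  have fin: "finite ?O" using card by (metis card.infinite zero_neq_numeral)
  have self: "d \<in> ?O" unfolding vertex_at_def
    using permutation_self_in_orbit[OF dessin_permutations(1)[OF dessin_shadow]] .
  have closed: "r x \<in> ?O" if "x \<in> ?O" for x
    using that unfolding vertex_at_def by (rule orbit.step)
  have ov: "r d \<in> over P \<longleftrightarrow> d \<notin> over P" "r (r d) \<in> over P \<longleftrightarrow> d \<in> over P"
    "r (r (r d)) \<in> over P \<longleftrightarrow> d \<notin> over P" "r (r (r (r d))) \<in> over P \<longleftrightarrow> d \<in> over P"
    using d by (simp_all add: over_rot)
  have d2: "r (r d) \<noteq> d"
  proof
    assume eq: "r (r d) = d"
    have "?O \<subseteq> {d, r d}" unfolding vertex_at_def
      by (rule orbit_subset_closed) (auto simp: eq)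
    then have "card ?O \<le> card {d, r d}" by (intro card_mono) auto
    also have "\<dots> \<le> 2" by (simp add: card_insert_if)
    finally show False using card by simp
  qed
  have odd: "r d \<noteq> d" "r (r (r d)) \<noteq> d" using ov by metis+
  show dist: "distinct [d, r d, r (r d), r (r (r d))]"
    using d2 odd by auto
  have sub: "{d, r d, r (r d), r (r (r d))} \<subseteq> ?O" using self closed by auto
  have "card {d, r d, r (r d), r (r (r d))} = 4" using distinct_card[OF dist] by simp
  then show O: "?O = {d, r d, r (r d), r (r (r d))}"
    using card_subset_eq[OF fin sub] card by simp
  have "r (r (r (r d))) \<in> ?O" using self closed by blast
  then show "r (r (r (r d))) = d" using ov O d2 odd by auto
qed

lemma r4 [simp]: "r (r (r (r d))) = d"
  using rot_four_distinct(2) permutes_not_in[OF dessin_rot[OF dessin_shadow]] by (cases "d \<in> darts G") auto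

lemma inv_r: "inv r d = r (r (r d))"
  by (rule inv_f_eq) (auto intro: injI)

text \<open>
  The corner between \<open>d\<close> and \<open>r d\<close> lies on the left of \<open>d\<close> and on the right of \<open>r d\<close>.
\<close>

lemma face_next_fl_r [simp]: "face_next G (fl (r d)) = d"
  by (simp add: face_next_def inv_r)

lemma splice_eq:
  "splice P S d = (if (vertex_at G d \<in> S) = (d \<in> over P) then r d else r (r (r d)))"
  by (simp add: splice_def Let_def inv_r)

lemma splice_darts [simp]: "splice P S d \<in> darts G \<longleftrightarrow> d \<in> darts G"
  by (simp add: splice_eq)

lemma splice_splice [simp]: "d \<in> darts G \<Longrightarrow> splice P S (splice P S d) = d"
  by (auto simp: splice_eq over_rot vertex_at_rot[OF dessin_shadow])

definition strand_relation :: "'d set set \<Rightarrow> ('d \<times> 'd) set" where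
  "strand_relation S = {(d, fl d) | d. d \<in> darts G} \<union> {(d, splice P S d) | d. d \<in> darts G}"

lemma circles_eq: "circles P S = (\<lambda>d. (strand_relation S)\<^sup>* `` {d}) ` darts G"
  by (simp add: circles_def strand_relation_def quotient_image)

lemma sym_strand_relation: "sym (strand_relation S)"
  unfolding sym_def strand_relation_def by auto

lemma circle_step:
  assumes "C \<in> circles P S" and d: "d \<in> darts G"
  shows "fl d \<in> C \<longleftrightarrow> d \<in> C" "splice P S d \<in> C \<longleftrightarrow> d \<in> C"
proof -
  let ?R = "strand_relation S"
  obtain c where C: "C = ?R\<^sup>* `` {c}" using assms(1) by (auto simp: circles_eq)
  have *: "y \<in> C \<longleftrightarrow> x \<in> C" if "(x, y) \<in> ?R" for x y
    using that symD[OF sym_strand_relation that] by (auto simp: C intro: rtrancl_into_rtrancl)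
  show "fl d \<in> C \<longleftrightarrow> d \<in> C" "splice P S d \<in> C \<longleftrightarrow> d \<in> C"
    using d by (auto intro!: * simp: strand_relation_def)
qed

lemma circle_induct:
  assumes C: "C \<in> circles P S" and d: "d \<in> C" and c: "c \<in> C" and Q: "Q d"
    and flQ: "\<And>x. x \<in> C \<Longrightarrow> Q x \<Longrightarrow> Q (fl x)"
    and splQ: "\<And>x. x \<in> C \<Longrightarrow> Q x \<Longrightarrow> Q (splice P S x)"
  shows "Q c"
proof -
  let ?R = "strand_relation S"
  obtain b where b: "b \<in> darts G" and Cb: "C = ?R\<^sup>* `` {b}" using C by (auto simp: circles_eq)
  have "(d, b) \<in> ?R\<^sup>*" "(b, c) \<in> ?R\<^sup>*"
    using d c sym_rtrancl[OF sym_strand_relation[of S]] by (auto simp: Cb dest: symD)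
  then have "(d, c) \<in> ?R\<^sup>*" by (rule rtrancl_trans)
  then have "c \<in> C \<and> Q c"
  proof induction
    case base
    show ?case using d Q by simp
  next
    case (step y z)
    then have z: "z = fl y \<or> z = splice P S y" and y: "y \<in> darts G" by (auto simp: strand_relation_def)
    then show ?case using step.IH flQ splQ circle_step[OF C y] by auto
  qed
  then show ?thesis by simp
qed

lemma circle_subset:
  assumes "C \<in> circles P S"
  shows "C \<subseteq> darts G"
proof
  fix c assume "c \<in> C"
  obtain b where b: "b \<in> darts G" and "C = (strand_relation S)\<^sup>* `` {b}"
    using assms by (auto simp: circles_eq)
  then have "b \<in> C" by auto
  show "c \<in> darts G" using assms \<open>b \<in> C\<close> \<open>c \<in> C\<close> b by (rule circle_induct) auto
qed

lemma circle_nonempty: "C \<in> circles P S \<Longrightarrow> C \<noteq> {}"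
  by (auto simp: circles_eq)

lemma circles_disjoint:
  assumes "C \<in> circles P S" "C' \<in> circles P S" "d \<in> C" "d \<in> C'"
  shows "C = C'"
proof -
  obtain b b' where "C = (strand_relation S)\<^sup>* `` {b}" "C' = (strand_relation S)\<^sup>* `` {b'}"
    using assms by (auto simp: circles_eq)
  then show ?thesis
    using assms(3,4) rtrancl_class_eq_iff[OF sym_strand_relation, of S] by (metis Image_singleton_iff)
qed

lemma circle_exists: "d \<in> darts G \<Longrightarrow> \<exists>C\<in>circles P S. d \<in> C"
  by (auto simp: circles_eq)

lemma finite_circles: "finite (circles P S)"
  using dessin_finite[OF dessin_shadow] by (simp add: circles_eq)

context
  fixes C assumes C: "C \<in> A_circles P"
begin

lemma C_fl: "d \<in> darts G \<Longrightarrow> fl d \<in> C \<longleftrightarrow> d \<in> C"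
  using circle_step(1)[OF C] .

lemma C_under: "d \<in> darts G \<Longrightarrow> d \<notin> over P \<Longrightarrow> r d \<in> C \<longleftrightarrow> d \<in> C"
  using circle_step(2)[OF C, of d] by (simp add: splice_eq)

text \<open>
  An all-A circle passes through a crossing along none, one or both of its two spliced strands, each of
  which uses two darts.
\<close>

lemma circle_even: "odd_vertices G C = {}"
proof -
  have "even (card (x \<inter> C))" if "x \<in> vertices G" for x
  proof -
    obtain e where e: "e \<in> darts G" "x = vertex_at G e" using \<open>x \<in> vertices G\<close> by (auto simp: vertices_def)
    define d where "d = (if e \<in> over P then r e else e)"
    have d: "d \<in> darts G" "d \<notin> over P" "x = vertex_at G d"
      using e over_rot vertex_at_rot[OF dessin_shadow] by (auto simp: d_def)
    note four = rot_four_distinct[OF d(1)]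
    have "r d \<in> C \<longleftrightarrow> d \<in> C" "r (r (r d)) \<in> C \<longleftrightarrow> r (r d) \<in> C"
      using d by (auto intro!: C_under simp: over_rot)
    then have "x \<inter> C = (if d \<in> C then {d, r d} else {}) \<union>
        (if r (r d) \<in> C then {r (r d), r (r (r d))} else {})"
      using d(3) four(3) by auto
    then show ?thesis using four(1) by auto
  qed
  then show ?thesis by (auto simp: odd_vertices_def)
qed

definition side_step :: "('d \<times> 'd) set" where
  "side_step = {(d, face_next G d) | d. d \<in> darts G} \<union>
      {(d, r (r d)) | d. d \<in> over P} \<union> {(d, fl d) | d. d \<in> darts G - C}"

lemma same_side_eq: "same_side P C = side_step\<^sup>*"
  by (simp add: same_side_def side_step_def Let_def)

text \<open>
  Faces are finite cycles, so walking around a face can be undone by walking on.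
\<close>

lemma sym_same_side: "sym (same_side P C)"
proof -
  have fn: "permutation (face_next G)"
    using face_next_permutes[OF dessin_shadow] dessin_finite[OF dessin_shadow] by (auto simp: permutation_permutes)
  have orb: "(x, y) \<in> side_step\<^sup>*" if "y \<in> orbit (face_next G) x" "x \<in> darts G" for x y
    using that(1)
  proof induction
    case base
    show ?case using that(2) by (auto simp: side_step_def)
  next
    case (step y)
    have "y \<in> darts G" using permutes_orbit_subset[OF face_next_permutes[OF dessin_shadow] that(2)] step.hyps by blast
    then have "(y, face_next G y) \<in> side_step" by (auto simp: side_step_def)
    with step.IH show ?case by (rule rtrancl_into_rtrancl)
  qed
  have "(y, x) \<in> side_step\<^sup>*" if "(x, y) \<in> side_step" for x y
    using that[unfolded side_step_def]
  proof (elim UnE CollectE exE conjE)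
    fix d assume d: "(x, y) = (d, face_next G d)" "d \<in> darts G"
    have "x \<in> orbit (face_next G) y"
      using d permutation_orbit_step[OF fn, of d] permutation_self_in_orbit[OF fn, of d] by simp
    moreover have "y \<in> darts G" using d permutes_in_image[OF face_next_permutes[OF dessin_shadow]] by simp
    ultimately show "(y, x) \<in> side_step\<^sup>*" by (rule orb)
  next
    fix d assume d: "(x, y) = (d, r (r d))" "d \<in> over P"
    then have "x = r (r y)" "y \<in> over P" using over_darts over_rot by auto
    then have "(y, x) \<in> side_step" unfolding side_step_def by blast
    then show "(y, x) \<in> side_step\<^sup>*" ..
  next
    fix d assume d: "(x, y) = (d, fl d)" "d \<in> darts G - C"
    then have "x = fl y" "y \<in> darts G - C" using C_fl by auto
    then have "(y, x) \<in> side_step" unfolding side_step_def by blast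
    then show "(y, x) \<in> side_step\<^sup>*" ..
  qed
  then have "side_step\<inverse> \<subseteq> side_step\<^sup>*" by auto
  then have "(side_step\<inverse>)\<^sup>* \<subseteq> side_step\<^sup>*" by (metis rtrancl_subset_rtrancl)
  then show ?thesis unfolding same_side_eq sym_conv_converse_eq
    by (metis converse_converse rtrancl_converse subset_antisym converse_mono)
qed

lemma enclosed_step:
  assumes "(x, y) \<in> side_step" "x \<in> darts G" "y \<in> darts G"
  shows "y \<in> enclosed P C \<longleftrightarrow> x \<in> enclosed P C"
proof -
  have "(x, y) \<in> same_side P C" "(y, x) \<in> same_side P C"
    using assms(1) sym_same_side by (auto simp: same_side_eq dest: symD)
  then show ?thesis using assms(2,3) unfolding enclosed_def
    by (auto simp: same_side_eq intro: rtrancl_trans)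
qed

lemma enclosed_face_next:
  "d \<in> darts G \<Longrightarrow> face_next G d \<in> enclosed P C \<longleftrightarrow> d \<in> enclosed P C"
  using permutes_in_image[OF face_next_permutes[OF dessin_shadow]]
  by (intro enclosed_step) (auto simp: side_step_def)

lemma enclosed_fl_r:
  "d \<in> darts G \<Longrightarrow> fl (r d) \<in> enclosed P C \<longleftrightarrow> d \<in> enclosed P C"
  using enclosed_face_next[of "fl (r d)"] by simp

lemma enclosed_over:
  "d \<in> over P \<Longrightarrow> r (r d) \<in> enclosed P C \<longleftrightarrow> d \<in> enclosed P C"
  using over_darts by (intro enclosed_step) (auto simp: side_step_def)

lemma enclosed_fl:
  "d \<in> darts G \<Longrightarrow> d \<notin> C \<Longrightarrow> fl d \<in> enclosed P C \<longleftrightarrow> d \<in> enclosed P C"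
  by (intro enclosed_step) (auto simp: side_step_def)

text \<open>
  Let \<open>U\<close> be a set of faces whose coboundary is the circle.  Moves that do not cross the circle do not leave
  or enter \<open>U\<close>, so all darts on the side of the unbounded face agree about \<open>U\<close>, whereas the two sides of an
  edge of the circle do not.
\<close>

lemma enclosed_one_side:
  assumes d: "d \<in> C"
  shows "\<not> (d \<notin> enclosed P C \<and> fl d \<notin> enclosed P C)"
proof -
  have dG: "d \<in> darts G" using d circle_subset[OF C] by auto
  have "C \<in> invariant_sets fl (darts G)"
    using circle_subset[OF C] C_fl by (auto simp: invariant_sets_def)
  then obtain U where U: "U \<in> invariant_sets (face_next G) (darts G)" and CU: "C = coboundary G U"
    using planar_cycle_is_coboundary[OF dessin_shadow shadow_connected shadow_planar _ circle_even] by blast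
  have U_face: "face_next G x \<in> U \<longleftrightarrow> x \<in> U" if "x \<in> darts G" for x
    using U that by (simp add: invariant_sets_def)
  have U_fl: "(fl x \<in> U \<longleftrightarrow> x \<in> U) \<longleftrightarrow> x \<notin> C" if "x \<in> darts G" for x
    using that by (auto simp: CU coboundary_def)
  have U_r: "(r x \<in> U \<longleftrightarrow> x \<in> U) \<longleftrightarrow> r x \<notin> C" if "x \<in> darts G" for x
    using U_face[of "fl (r x)"] U_fl[of "r x"] that by auto
  have U_step: "y \<in> U \<longleftrightarrow> x \<in> U" if "(x, y) \<in> side_step" for x y
  proof -
    \<comment> \<open>Turning from z to r (r z) passes the edges of r z and r (r z), which are joined by an A-spliced
      strand: the circle contains both or neither.\<close>
    have "r (r z) \<in> U \<longleftrightarrow> z \<in> U" if "z \<in> over P" for z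
      using U_r[of z] U_r[of "r z"] C_under[of "r z"] over_darts that over_rot by auto
    then show ?thesis using that U_face U_fl by (auto simp: side_step_def)
  qed
  have U_same: "y \<in> U \<longleftrightarrow> x \<in> U" if "(x, y) \<in> same_side P C" for x y
    using that unfolding same_side_eq by induction (auto simp: U_step)
  obtain a where a: "a \<in> darts G" "outer P = orbit (face_next G) a" using outer_face by (auto simp: faces_def)
  have outer_U: "x \<in> U \<longleftrightarrow> a \<in> U" if "x \<in> outer P" for x
    using that unfolding a(2)
  proof induction
    case base
    show ?case using U_face a by simp
  next
    case (step y)
    have "y \<in> darts G" using permutes_orbit_subset[OF face_next_permutes[OF dessin_shadow] a(1)] step.hyps by blast
    then show ?case using step.IH U_face by simp
  qed
  have "x \<in> U \<longleftrightarrow> a \<in> U" if "x \<in> darts G" "x \<notin> enclosed P C" for x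
    using that outer_U U_same by (auto simp: enclosed_def)
  then show ?thesis using U_fl[OF dG] d dG fl_darts[of d] by blast
qed

text \<open>
  By connectedness, the unbounded face can be joined to some edge of the circle without crossing it.
\<close>

lemma outer_side_reaches_circle: "\<exists>c\<in>C. c \<notin> enclosed P C"
proof -
  define L where "L = {y \<in> darts G. \<exists>c\<in>C. (c, y) \<in> same_side P C}"
  have step: "y \<in> L \<longleftrightarrow> x \<in> L" if "(x, y) \<in> side_step" "x \<in> darts G" "y \<in> darts G" for x y
  proof -
    have "(x, y) \<in> same_side P C" "(y, x) \<in> same_side P C"
      using that(1) sym_same_side by (auto simp: same_side_eq dest: symD)
    then show ?thesis using that(2,3) unfolding L_def
      by (auto simp: same_side_eq intro: rtrancl_trans)
  qed
  have CL: "C \<subseteq> L" using circle_subset[OF C] by (auto simp: L_def same_side_eq)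
  have L_face: "face_next G d \<in> L \<longleftrightarrow> d \<in> L" if "d \<in> darts G" for d
    using that permutes_in_image[OF face_next_permutes[OF dessin_shadow]]
    by (intro step) (auto simp: side_step_def)
  have L_fl: "fl d \<in> L \<longleftrightarrow> d \<in> L" if "d \<in> darts G" for d
  proof (cases "d \<in> C")
    case True
    then show ?thesis using CL C_fl[OF that] by auto
  next
    case False
    then show ?thesis using that by (intro step) (auto simp: side_step_def)
  qed
  have L_r: "r d \<in> L \<longleftrightarrow> d \<in> L" if "d \<in> darts G" for d
    using L_face[of "fl (r d)"] L_fl[of "r d"] that by simp
  have "L = {} \<or> L = darts G"
    using L_fl L_r by (intro connected_invariant_set[OF dessin_shadow shadow_connected]) (auto simp: invariant_sets_def L_def)
  then have "L = darts G" using CL circle_nonempty[OF C] by auto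
  moreover obtain a where a: "a \<in> darts G" "outer P = orbit (face_next G) a"
    using outer_face by (auto simp: faces_def)
  moreover have "a \<in> outer P" unfolding a(2)
    using face_next_permutes[OF dessin_shadow] dessin_finite[OF dessin_shadow]
    by (intro permutation_self_in_orbit) (auto simp: permutation_permutes)
  ultimately obtain c where "c \<in> C" "(c, a) \<in> same_side P C" by (auto simp: L_def)
  then have "(a, c) \<in> same_side P C" using sym_same_side by (metis symD)
  then show ?thesis using \<open>c \<in> C\<close> \<open>a \<in> outer P\<close> by (auto simp: enclosed_def)
qed

text \<open>
  The side of the unbounded face touches the circle somewhere, and following the circle one keeps that
  side on the same hand.
\<close>

lemma enclosed_other_side:
  assumes d: "d \<in> C"
  shows "d \<notin> enclosed P C \<or> fl d \<notin> enclosed P C"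
proof -
  obtain c where c: "c \<in> C" "c \<notin> enclosed P C" using outer_side_reaches_circle by blast
  let ?Q = "\<lambda>d. d \<notin> enclosed P C \<or> fl d \<notin> enclosed P C"
  have under: "(fl (r x) \<in> enclosed P C \<longleftrightarrow> x \<in> enclosed P C) \<and>
      (fl x \<in> enclosed P C \<longleftrightarrow> r x \<in> enclosed P C)" if "x \<in> darts G" "x \<notin> over P" for x
    using enclosed_fl_r[of x] enclosed_fl_r[of "r (r (r x))"] enclosed_over[of "r x"] that
    by (simp add: over_rot)
  show ?thesis
  proof (rule circle_induct[OF C c(1) d])
    show "?Q c" using c by simp
    fix x assume x: "x \<in> C" "?Q x"
    then have xG: "x \<in> darts G" using circle_subset[OF C] by auto
    show "?Q (fl x)" using x by auto
    show "?Q (splice P {} x)"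
    proof (cases "x \<in> over P")
      case True
      then show ?thesis using under[of "r (r (r x))"] xG x by (auto simp: splice_eq over_rot)
    next
      case False
      then show ?thesis using under[of x] xG x by (auto simp: splice_eq)
    qed
  qed
qed

text \<open>
  The Jordan curve theorem for all-A circles: their edges, and no others, have one side inside and one
  outside.
\<close>

theorem enclosed_separates:
  assumes "d \<in> darts G"
  shows "(fl d \<in> enclosed P C \<longleftrightarrow> d \<in> enclosed P C) \<longleftrightarrow> d \<notin> C"
  using enclosed_fl[OF assms] enclosed_one_side enclosed_other_side by blast

text \<open>
  Another circle does not cross this one, so it lies on one side of it.
\<close>

lemma enclosed_circle:
  assumes C': "C' \<in> A_circles P" "C' \<noteq> C" and d: "d \<in> C'"
  shows "C' \<subseteq> enclosed P C \<longleftrightarrow> d \<in> enclosed P C"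
proof
  assume dC: "d \<in> enclosed P C"
  have disj: "x \<notin> C" if "x \<in> C'" for x using circles_disjoint[OF C C'(1)] C'(2) that by blast
  show "C' \<subseteq> enclosed P C"
  proof
    fix c assume c: "c \<in> C'"
    show "c \<in> enclosed P C"
      using C'(1) d c dC
    proof (rule circle_induct)
      fix x assume x: "x \<in> C'" "x \<in> enclosed P C"
      then have xG: "x \<in> darts G" using circle_subset[OF C'(1)] by auto
      show "fl x \<in> enclosed P C" using x enclosed_fl[OF xG disj] by simp
      have sC': "splice P {} x \<in> C'" using circle_step(2)[OF C'(1) xG] x by simp
      show "splice P {} x \<in> enclosed P C"
      proof (cases "x \<in> over P")
        case True
        then have s: "splice P {} x = r (r (r x))" by (simp add: splice_eq)
        have "fl x \<in> enclosed P C \<longleftrightarrow> r (r (r x)) \<in> enclosed P C"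
          using enclosed_fl_r[of "r (r (r x))"] xG by simp
        then show ?thesis using s x enclosed_fl[OF xG disj] by simp
      next
        case False
        then have s: "splice P {} x = r x" by (simp add: splice_eq)
        have "fl (r x) \<in> enclosed P C" using enclosed_fl_r[OF xG] x by simp
        then show ?thesis using s enclosed_fl[of "r x"] xG disj sC' by simp
      qed
    qed
  qed
qed (use d in auto)

end

text \<open>
  The other circles around \<open>d\<close> are counted by the nesting depth of its own circle, and its own circle
  counts iff \<open>d\<close> points counterclockwise.  In this form the condition is local at \<open>d\<close>.
\<close>

lemma forward_iff:
  assumes d: "d \<in> darts G"
  shows "d \<in> forward P \<longleftrightarrow> odd (card {C \<in> A_circles P. d \<in> enclosed P C})"
proof -
  obtain C where C: "C \<in> A_circles P" "d \<in> C" using circle_exists[OF d] by blast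
  have "d \<in> forward P \<longleftrightarrow> (odd (nesting_depth P C) \<longleftrightarrow> d \<notin> enclosed P C)"
    using C circles_disjoint by (fastforce simp: forward_def)
  also have "nesting_depth P C = card ({C' \<in> A_circles P. d \<in> enclosed P C'} - {C})"
  proof -
    have "{C' \<in> A_circles P. C' \<noteq> C \<and> C \<subseteq> enclosed P C'} = {C' \<in> A_circles P. d \<in> enclosed P C'} - {C}"
      using enclosed_circle C by blast
    then show ?thesis by (simp add: nesting_depth_def)
  qed
  finally show ?thesis using C finite_circles[of "{}"]
    by (cases "d \<in> enclosed P C") (auto simp: card_Diff_singleton_if card_gt_0_iff)
qed

lemma forward_darts: "forward P \<subseteq> darts G"
  using circle_subset by (auto simp: forward_def)

text \<open>
  Crossing an edge changes sides with respect to exactly one circle, the one through it.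
\<close>

lemma forward_fl:
  assumes d: "d \<in> darts G"
  shows "fl d \<in> forward P \<longleftrightarrow> d \<notin> forward P"
proof -
  obtain C where C: "C \<in> A_circles P" "d \<in> C" using circle_exists[OF d] by blast
  let ?N = "\<lambda>d. {C \<in> A_circles P. d \<in> enclosed P C}"
  have "C' \<in> ?N (fl d) \<longleftrightarrow> C' \<in> sdiff (?N d) {C}" for C'
  proof (cases "C' \<in> A_circles P")
    case C': True
    have "C' = C" if "d \<in> C'" using circles_disjoint[OF C' C(1) that C(2)] .
    then show ?thesis using enclosed_separates[OF C' d] C' C(2) by auto
  next
    case False
    then show ?thesis using C(1) by auto
  qed
  then have "?N (fl d) = sdiff (?N d) {C}" by (rule set_eqI)
  moreover have fin: "finite (?N d)" using finite_circles by simp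
  ultimately have "odd (card (?N (fl d))) \<longleftrightarrow> even (card (?N d))"
    using even_card_sdiff[of "?N d" "{C}"] by simp
  then show ?thesis using forward_iff d by simp
qed

text \<open>
  The left side of \<open>d\<close> is the right side of \<open>r d\<close>, so this is \<open>forward_fl\<close> for \<open>r d\<close>.  In particular \<open>d\<close> and
  \<open>r (r d)\<close> are both forward or both not: the bands of the all-A dessin are untwisted, and every splicing
  joins a forward dart to a backward one.
\<close>

lemma forward_rot:
  assumes d: "d \<in> darts G"
  shows "r d \<in> forward P \<longleftrightarrow> d \<notin> forward P"
proof -
  have "{C \<in> A_circles P. fl (r d) \<in> enclosed P C} = {C \<in> A_circles P. d \<in> enclosed P C}"
    using enclosed_fl_r[OF _ d] by auto
  then have "fl (r d) \<in> forward P \<longleftrightarrow> d \<in> forward P" using forward_iff d by simp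
  then show ?thesis using forward_fl[of "r d"] d by auto
qed

end

section \<open>States as ribbon subgraphs of the all-A dessin\<close>

context plane_link_diagram
begin

abbreviation "D \<equiv> all_A_dessin P"
abbreviation "E \<equiv> darts (shadow P) - over P"

text \<open>
  The forward end of the A-spliced strand on which the arc-end \<open>u\<close> lies.
\<close>

definition strand_exit :: "'d \<Rightarrow> 'd" where
  "strand_exit u = (if u \<in> forward P then u else r u)"

text \<open>
  For a forward dart \<open>d\<close>: the next forward dart on its circle in the state \<open>S\<close>.
\<close>

definition traverse :: "'d set set \<Rightarrow> 'd \<Rightarrow> 'd" where
  "traverse S d = splice P S (fl d)"

lemma splice_permutes: "splice P S permutes darts G"
proof (rule bij_imp_permutes)
  show "bij_betw (splice P S) (darts G) (darts G)"
    by (rule bij_betwI[where g = "splice P S"]) auto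
  show "splice P S x = x" if "x \<notin> darts G" for x
    using permutes_not_in[OF dessin_rot[OF dessin_shadow] that] by (simp add: splice_eq)
qed

lemma traverse_permutation: "permutation (traverse S)"
proof -
  have "traverse S = splice P S \<circ> fl" by (simp add: traverse_def fun_eq_iff)
  then have "traverse S permutes darts G"
    using permutes_compose[OF dessin_flip[OF dessin_shadow] splice_permutes] by simp
  then show ?thesis using dessin_finite[OF dessin_shadow] by (auto simp: permutation_permutes)
qed

lemma splice_forward:
  assumes "d \<in> darts G"
  shows "splice P S d \<in> forward P \<longleftrightarrow> d \<notin> forward P"
  using assms forward_rot by (simp add: splice_eq)

lemma traverse_forward: "d \<in> forward P \<Longrightarrow> traverse S d \<in> forward P"
  using forward_darts forward_fl splice_forward[of "fl d"] by (auto simp: traverse_def)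

text \<open>
  Every circle of every state is consistently oriented by the forward darts, so it is determined by the
  cycle of \<open>traverse S\<close> formed by the forward darts on it.
\<close>

lemma card_circles: "card (circles P S) = cycle_count (traverse S) (forward P)"
proof -
  let ?R = "strand_relation S" and ?o = "orbit (traverse S)"
  \<comment> \<open>the forward dart on the same edge\<close>
  let ?rep = "\<lambda>d. if d \<in> forward P then d else fl d"
  let ?c = "\<lambda>d. ?R\<^sup>* `` {d}"
  note pt = traverse_permutation[of S]
  have fwd: "d \<in> darts G" if "d \<in> forward P" for d using that forward_darts by auto
  have fl_R: "(d, fl d) \<in> ?R" and spl_R: "(d, splice P S d) \<in> ?R" if "d \<in> darts G" for d
    using that by (auto simp: strand_relation_def)
  have orbit_step: "?o (?rep z) = ?o (?rep y)" if "(y, z) \<in> ?R" for y z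
  proof -
    have y: "y \<in> darts G" and z: "z = fl y \<or> z = splice P S y"
      using that by (auto simp: strand_relation_def)
    show ?thesis
    proof (cases "z = fl y")
      case True
      then show ?thesis using forward_fl[OF y] by simp
    next
      case False
      then have z: "z = splice P S y" using z by simp
      show ?thesis
      proof (cases "y \<in> forward P")
        case True
        then have "traverse S (?rep z) = ?rep y"
          using splice_forward[OF y] y by (simp add: z traverse_def)
        then show ?thesis using permutation_orbit_step[OF pt] by metis
      next
        case False
        then have "traverse S (?rep y) = ?rep z"
          using splice_forward[OF y] y by (simp add: z traverse_def)
        then show ?thesis using permutation_orbit_step[OF pt] by metis
      qed
    qed
  qed
  have to_orbit: "?o (?rep z) = ?o (?rep y)" if "(y, z) \<in> ?R\<^sup>*" for y z
    using that by induction (use orbit_step in auto)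
  have from_orbit: "(x, y) \<in> ?R\<^sup>*" if "y \<in> ?o x" "x \<in> forward P" for x y
  proof -
    have trav: "(y, traverse S y) \<in> ?R\<^sup>*" if "y \<in> forward P" for y
      using fl_R[of y] spl_R[of "fl y"] fwd[OF that] unfolding traverse_def
      by (auto intro: converse_rtrancl_into_rtrancl)
    have "y \<in> forward P \<and> (x, y) \<in> ?R\<^sup>*"
      using that(1)
    proof induction
      case base
      show ?case using trav traverse_forward \<open>x \<in> forward P\<close> by simp
    next
      case (step y)
      then show ?case using trav traverse_forward by (auto intro: rtrancl_trans)
    qed
    then show ?thesis by simp
  qed
  have "circles P S = ?c ` forward P"
  proof -
    have "?c d \<in> ?c ` forward P" if d: "d \<in> darts G" for d
    proof (cases "d \<in> forward P")
      case False
      then have "fl d \<in> forward P" using forward_fl[OF d] by simp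
      moreover have "?c d = ?c (fl d)"
        using rtrancl_class_eq_iff[OF sym_strand_relation, of S] fl_R[OF d] by blast
      ultimately show ?thesis by blast
    qed blast
    then show ?thesis using fwd unfolding circles_eq by blast
  qed
  also have "card (?c ` forward P) = card (?o ` forward P)"
  proof (rule antisym)
    have fin: "finite (forward P)" using forward_darts dessin_finite[OF dessin_shadow] by (rule finite_subset)
    show "card (?c ` forward P) \<le> card (?o ` forward P)"
    proof (rule card_image_le_kernel[OF fin])
      fix x y assume x: "x \<in> forward P" "y \<in> forward P" "?o x = ?o y"
      then have "(y, x) \<in> ?R\<^sup>*" using orbit_eq_iff[OF pt] by (intro from_orbit) auto
      then show "?c x = ?c y" using rtrancl_class_eq_iff[OF sym_strand_relation, of S y x] by simp
    qed
    show "card (?o ` forward P) \<le> card (?c ` forward P)"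
    proof (rule card_image_le_kernel[OF fin])
      fix x y assume x: "x \<in> forward P" "y \<in> forward P" "?c x = ?c y"
      then have "(y, x) \<in> ?R\<^sup>*" by blast
      then show "?o x = ?o y" using to_orbit[of y x] x by simp
    qed
  qed
  finally show ?thesis .
qed

lemma darts_D: "darts D = E" and rot_D: "u \<in> E \<Longrightarrow> rot D u = next_arc_end P u"
  and flip_D: "u \<in> E \<Longrightarrow> flip D u = r (r u)"
  by (simp_all add: all_A_dessin_def Let_def)

lemma strand_exit_bij: "bij_betw strand_exit E (forward P)"
proof (rule bij_betwI[where g = "\<lambda>x. if x \<in> over P then r (r (r x)) else x"])
  show "strand_exit \<in> E \<rightarrow> forward P"
    using forward_rot by (auto simp: strand_exit_def)
  show "(\<lambda>x. if x \<in> over P then r (r (r x)) else x) \<in> forward P \<rightarrow> E"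
  proof
    fix x assume "x \<in> forward P"
    then have "x \<in> darts G" using forward_darts by auto
    then show "(if x \<in> over P then r (r (r x)) else x) \<in> E" by (simp add: over_rot)
  qed
  show "(if strand_exit u \<in> over P then r (r (r (strand_exit u))) else strand_exit u) = u" if "u \<in> E" for u
    using that by (auto simp: strand_exit_def over_rot)
  show "strand_exit (if x \<in> over P then r (r (r x)) else x) = x" if "x \<in> forward P" for x
    using that forward_darts forward_rot by (auto simp: strand_exit_def subset_iff)
qed

lemma next_arc_end:
  assumes u: "u \<in> E"
  shows "next_arc_end P u \<in> E" and "strand_exit (next_arc_end P u) = traverse {} (strand_exit u)"
    and "vertex_at G (next_arc_end P u) = vertex_at G (fl (strand_exit u))"
proof -
  define e where "e = fl (strand_exit u)"
  have fw: "strand_exit u \<in> forward P" using bij_betw_apply[OF strand_exit_bij u] .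
  then have e: "e \<in> darts G" "e \<notin> forward P"
    unfolding e_def using forward_darts forward_fl by auto
  have eq: "next_arc_end P u = (if e \<in> over P then r (r (r e)) else e)"
    by (simp add: next_arc_end_def e_def strand_exit_def Let_def inv_r)
  show "next_arc_end P u \<in> E" using e by (simp add: eq over_rot)
  show "strand_exit (next_arc_end P u) = traverse {} (strand_exit u)"
  proof -
    have "traverse {} (strand_exit u) = splice P {} e" by (simp add: traverse_def e_def)
    moreover have "r (r (r e)) \<in> forward P" using e forward_rot by simp
    ultimately show ?thesis using e(2) by (simp add: eq strand_exit_def splice_eq)
  qed
  show "vertex_at G (next_arc_end P u) = vertex_at G (fl (strand_exit u))"
    by (simp add: eq vertex_at_rot[OF dessin_shadow] flip: e_def)
qed

lemma rr_E: "u \<in> E \<Longrightarrow> r (r u) \<in> E"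
  by (simp add: over_rot)

text \<open>
  Through \<open>strand_exit\<close>, passing to the next arc-end is walking along the all-A state, which is
  invertible.
\<close>

lemma dessin_D: "dessin D"
proof -
  have fin: "finite E" using dessin_finite[OF dessin_shadow] by simp
  have "inj_on (next_arc_end P) E"
  proof (rule inj_onI)
    fix u w assume uw: "u \<in> E" "w \<in> E" "next_arc_end P u = next_arc_end P w"
    then have "traverse {} (strand_exit u) = traverse {} (strand_exit w)"
      using next_arc_end(2) by metis
    then have "strand_exit u = strand_exit w"
      using traverse_permutation[of "{}"] by (metis permutation_bijective bij_pointE)
    then show "u = w" using strand_exit_bij uw by (metis bij_betw_def inj_onD)
  qed
  moreover have "next_arc_end P ` E \<subseteq> E" using next_arc_end(1) by blast
  ultimately have "bij_betw (next_arc_end P) E E"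
    using fin by (simp add: bij_betw_def endo_inj_surj)
  then have "bij_betw (rot D) E E"
    using rot_D by (subst bij_betw_cong) auto
  then have rot: "rot D permutes E"
    by (rule bij_imp_permutes) (auto simp: all_A_dessin_def Let_def)
  have "bij_betw (flip D) E E"
    by (rule bij_betwI[where g = "flip D"]) (auto simp: flip_D over_rot)
  then have flip: "flip D permutes E"
    by (rule bij_imp_permutes) (auto simp: all_A_dessin_def Let_def)
  have "flip D u \<noteq> u \<and> flip D (flip D u) = u" if "u \<in> E" for u
    using that rot_four_distinct(1)[of u] rr_E[OF that] by (auto simp: flip_D)
  then show ?thesis unfolding dessin_def darts_D using fin rot flip by blast
qed

lemma edge_at_D: "u \<in> E \<Longrightarrow> edge_at D u = vertex_at G u - over P"
  using rot_four_distinct(3)[of u] by (auto simp: edge_at_def flip_D over_rot)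

lemma edges_D: "edges D = (\<lambda>x. x - over P) ` crossings P"
proof -
  have "vertex_at G d - over P \<in> edges D" if "d \<in> darts G" for d
  proof (cases "d \<in> over P")
    case True
    then have u: "r d \<in> E" using that by (simp add: over_rot)
    then have "edge_at D (r d) = vertex_at G d - over P"
      using edge_at_D vertex_at_rot[OF dessin_shadow] by simp
    then show ?thesis using u unfolding edges_def darts_D by blast
  next
    case False
    then have "d \<in> E" using that by simp
    then show ?thesis using edge_at_D unfolding edges_def darts_D by blast
  qed
  moreover have "edge_at D u \<in> (\<lambda>x. x - over P) ` crossings P" if "u \<in> E" for u
    using that edge_at_D by (auto simp: vertices_def)
  ultimately show ?thesis unfolding edges_def darts_D by (auto simp: vertices_def)
qed

lemma crossing_edge_inj: "inj_on (\<lambda>x. x - over P) (crossings P)"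
proof (rule inj_onI)
  fix x y assume x: "x \<in> crossings P" and y: "y \<in> crossings P" and eq: "x - over P = y - over P"
  obtain d where d: "d \<in> darts G" "x = vertex_at G d" using x by (auto simp: vertices_def)
  define u where "u = (if d \<in> over P then r d else d)"
  have "u \<in> x - over P"
    using rot_four_distinct(3)[OF d(1)] d by (auto simp: u_def over_rot)
  then have "u \<in> x" "u \<in> y" using eq by auto
  then show "x = y" using in_vertex_iff[OF dessin_shadow] x y by metis
qed

text \<open>
  The bijection \<open>strand_exit\<close> from arc-ends to forward darts turns the boundary walk of the
  ribbon subgraph into the walk along the state: crossing a band and B-splicing its crossing both add
  a half-turn around that crossing to the step along the all-A circle.
\<close>

lemma boundary_count_circles:
  assumes S: "S \<subseteq> crossings P"
  shows "boundary_count D ((\<lambda>x. x - over P) ` S) = card (circles P S)"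
proof -
  let ?S = "(\<lambda>x. x - over P) ` S"
  have mem: "edge_at D u \<in> ?S \<longleftrightarrow> vertex_at G u \<in> S" if u: "u \<in> E" for u
  proof -
    have "vertex_at G u \<in> crossings P" using u by (auto simp: vertices_def)
    then show ?thesis unfolding edge_at_D[OF u]
      using inj_on_image_mem_iff[OF crossing_edge_inj _ S] by blast
  qed
  have "cycle_count (traverse S) (forward P) = cycle_count (boundary D ?S) E"
  proof (rule cycle_count_conj)
    show "permutation (boundary D ?S)" using dessin_D by (rule boundary_permutation)
    show "permutation (traverse S)" by (rule traverse_permutation)
    show "bij_betw strand_exit E (forward P)" by (rule strand_exit_bij)
    show "boundary D ?S u \<in> E" if "u \<in> E" for u
      using that permutes_in_image[OF boundary_permutes[OF dessin_D]] unfolding darts_D by blast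
    show "strand_exit (boundary D ?S u) = traverse S (strand_exit u)" if u: "u \<in> E" for u
    proof -
      let ?w = "next_arc_end P u" and ?e = "fl (strand_exit u)"
      note w = next_arc_end[OF u]
      have "strand_exit u \<in> forward P" using bij_betw_apply[OF strand_exit_bij u] .
      then have e: "?e \<in> darts G" using forward_darts by auto
      have "strand_exit (r (r ?w)) = r (r (strand_exit ?w))"
        using w(1) forward_rot by (simp add: strand_exit_def)
      then have "strand_exit (boundary D ?S u) =
          (if vertex_at G ?e \<in> S then r (r (traverse {} (strand_exit u))) else traverse {} (strand_exit u))"
        using w mem[OF w(1)] by (simp add: boundary_def flip_on_def rot_D[OF u] flip_D)
      also have "\<dots> = traverse S (strand_exit u)"
        by (simp add: traverse_def splice_eq)
      finally show ?thesis .
    qed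
  qed
  then show ?thesis using card_circles[of S] by (simp add: darts_D)
qed

lemma E_nonempty: "E \<noteq> {}"
proof -
  have "graph_components G (edges G) \<noteq> {}" using shadow_connected by auto
  then obtain d where "d \<in> darts G" by (auto simp: graph_components_def quotient_image vertices_def)
  then have "d \<in> E \<or> r d \<in> E" by (simp add: over_rot)
  then show ?thesis by blast
qed

end

section \<open>The determinant\<close>

text \<open>
  At \<open>A = exp (- \<i> \<pi> / 4)\<close> the loop factor is zero, and \<open>0 ^ 0 = 1\<close> keeps the states with one circle.  The
  writhe factor and \<open>A ^ card (crossings P)\<close> are units.
\<close>

lemma link_det_eq:
  assumes "finite (crossings P)" and ne: "\<And>S. S \<subseteq> crossings P \<Longrightarrow> circles P S \<noteq> {} \<and> finite (circles P S)"
  shows "link_det P = cmod (\<Sum>S\<in>{S \<in> Pow (crossings P). card (circles P S) = 1}. \<i> ^ card S)"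
proof -
  define A :: complex where "A = (-1) powr (- 1 / 4)"
  have A: "A = cis (- pi / 4)"
    by (simp add: A_def powr_def cis_conv_exp mult.commute)
  have normA: "cmod A = 1" by (simp add: A)
  have A0: "A \<noteq> 0" using normA by auto
  have A2: "A ^ 2 = - \<i>"
    unfolding A power2_eq_square cis_mult by (simp add: complex_eq_iff)
  have Am2: "A powi (-2) = \<i>"
    using A2 by (simp add: power_int_minus)
  let ?n = "card (crossings P)"
  have summand: "A powi (int (card (crossings P - S)) - int (card S)) *
        (- (A ^ 2) - A powi (-2)) ^ (card (circles P S) - 1) =
      (if card (circles P S) = 1 then A ^ ?n * \<i> ^ card S else 0)" if S: "S \<subseteq> crossings P" for S
  proof -
    have "finite S" using S assms(1) finite_subset by blast
    then have "int (card (crossings P - S)) - int (card S) = int ?n + (-2) * int (card S)"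
      using S assms(1) by (simp add: card_Diff_subset card_mono of_nat_diff)
    then have "A powi (int (card (crossings P - S)) - int (card S)) = A ^ ?n * (A powi (-2)) ^ card S"
      using power_int_add[of A "int ?n" "(-2) * int (card S)"] power_int_mult[of A "-2" "int (card S)"] A0
      by (simp only: power_int_of_nat) simp
    moreover have "card (circles P S) \<noteq> 0" using ne[OF S] by simp
    ultimately show ?thesis unfolding Am2 A2 by auto
  qed
  have "kauffman_bracket P A = (\<Sum>S\<in>Pow (crossings P).
      if card (circles P S) = 1 then A ^ ?n * \<i> ^ card S else 0)"
    unfolding kauffman_bracket_def by (rule sum.cong[OF refl], rule summand) simp
  also have "\<dots> = (\<Sum>S\<in>{S \<in> Pow (crossings P). card (circles P S) = 1}. A ^ ?n * \<i> ^ card S)"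
    using assms(1) by (subst sum.inter_filter) auto
  finally have "kauffman_bracket P A = A ^ ?n * (\<Sum>S\<in>{S \<in> Pow (crossings P). card (circles P S) = 1}. \<i> ^ card S)"
    by (simp add: sum_distrib_left)
  then show ?thesis
    unfolding link_det_def jones_def Let_def A_def[symmetric]
    by (simp add: norm_mult norm_power norm_power_int normA)
qed

theorem corollary4p2:
  fixes P :: "'d link_diagram" and D :: "'d dessin"
  assumes "connected_link_diagram P"
    and "D = all_A_dessin P"
    and "genus D = 1"
  shows "link_det P =
    \<bar>real (card (spanning_trees D)) - real (card (spanning_trees (dual D)))\<bar>"
proof -
  interpret plane_link_diagram P by unfold_locales (rule assms(1))
  let ?E = "edges D" and ?\<phi> = "\<lambda>S. (\<lambda>x. x - over P) ` S"
  have D: "dessin D" using dessin_D assms(2) by simp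
  have ne: "darts D \<noteq> {}" using E_nonempty darts_D assms(2) by simp
  have D': "dessin (dual D)" and ne': "darts (dual D) \<noteq> {}" using D ne by (simp_all add: dessin_dual dual_simps)
  define v where "v = card (vertices D)"
  have v: "v \<noteq> 0" using ne finite_vertices[OF D] by (simp add: v_def vertices_def)
  have bij: "bij_betw ?\<phi> (Pow (crossings P)) (Pow ?E)"
    using crossing_edge_inj edges_D assms(2) by (simp add: bij_betw_def inj_on_image_Pow image_Pow_surj)
  let ?one = "{S \<in> Pow ?E. boundary_count D S = 1}"
  let ?trees = "{S \<in> ?one. Suc (card S) = v}" and ?cotrees = "{S \<in> ?one. card S = Suc v}"
  have bc: "boundary_count D (?\<phi> S) = card (circles P S)" if "S \<subseteq> crossings P" for S
    using boundary_count_circles[OF that] assms(2) by simp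
  have "link_det P = cmod (\<Sum>S\<in>{S \<in> Pow (crossings P). card (circles P S) = 1}. \<i> ^ card S)"
  proof (rule link_det_eq)
    show "finite (crossings P)" by (rule finite_vertices[OF dessin_shadow])
    show "circles P S \<noteq> {} \<and> finite (circles P S)" for S
      using finite_circles E_nonempty by (auto simp: circles_eq)
  qed
  also have "(\<Sum>S\<in>{S \<in> Pow (crossings P). card (circles P S) = 1}. \<i> ^ card S) =
      (\<Sum>S\<in>{S \<in> Pow (crossings P). card (circles P S) = 1}. \<i> ^ card (?\<phi> S))"
  proof (rule sum.cong[OF refl])
    fix S assume "S \<in> {S \<in> Pow (crossings P). card (circles P S) = 1}"
    then have "inj_on (\<lambda>x. x - over P) S" using crossing_edge_inj by (auto intro: inj_on_subset)
    then show "\<i> ^ card S = \<i> ^ card (?\<phi> S)" by (simp add: card_image)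
  qed
  also have "\<dots> = (\<Sum>S\<in>?one. \<i> ^ card S)"
  proof (rule sum.reindex_bij_betw)
    show "bij_betw ?\<phi> {S \<in> Pow (crossings P). card (circles P S) = 1} ?one"
      using bij bc by (intro bij_betw_Collect) auto
  qed
  also have "?one = ?trees \<union> ?cotrees"
    using genus_one_one_boundary(1)[OF D ne assms(3)] by (auto simp: v_def)
  also have "(\<Sum>S\<in>?trees \<union> ?cotrees. \<i> ^ card S) =
      (\<Sum>S\<in>?trees. \<i> ^ card S) + (\<Sum>S\<in>?cotrees. \<i> ^ card S)"
    using finite_edges[OF D] by (intro sum.union_disjoint) auto
  also have "(\<Sum>S\<in>?trees. \<i> ^ card S) = (\<Sum>S\<in>?trees. \<i> ^ (v - 1))"
    by (intro sum.cong) auto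
  also have "(\<Sum>S\<in>?cotrees. \<i> ^ card S) = (\<Sum>S\<in>?cotrees. - (\<i> ^ (v - 1)))"
    using v by (intro sum.cong) (auto simp: power_Suc2 gr0_conv_Suc)
  also have "(\<Sum>S\<in>?trees. \<i> ^ (v - 1)) + (\<Sum>S\<in>?cotrees. - (\<i> ^ (v - 1))) =
      \<i> ^ (v - 1) * of_real (real (card ?trees) - real (card ?cotrees))"
    by (simp add: algebra_simps)
  also have "cmod \<dots> = \<bar>real (card ?trees) - real (card ?cotrees)\<bar>"
    by (simp add: norm_mult norm_power del: of_real_diff)
  also have "?trees = spanning_trees D"
    using spanning_tree_iff_boundary_count[OF D ne] by (auto simp: v_def)
  also have "card ?cotrees = card (spanning_trees (dual D))"
  proof (rule bij_betw_same_card[OF bij_betwI[where f = "\<lambda>S. ?E - S" and g = "\<lambda>S. ?E - S"]])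
    have iff: "?E - S \<in> spanning_trees (dual D) \<longleftrightarrow> S \<in> ?cotrees" if "S \<subseteq> ?E" for S
      using spanning_tree_iff_boundary_count[OF D' ne', of "?E - S"]
        boundary_count_dual[OF D, of S] genus_one_one_boundary(3)[OF D ne assms(3) that] that
      by (auto simp: edges_dual vertices_dual v_def)
    show "(\<lambda>S. ?E - S) \<in> ?cotrees \<rightarrow> spanning_trees (dual D)" using iff by auto
    show "(\<lambda>S. ?E - S) \<in> spanning_trees (dual D) \<rightarrow> ?cotrees"
    proof
      fix T assume T: "T \<in> spanning_trees (dual D)"
      then have "T \<subseteq> ?E" by (simp add: spanning_trees_def edges_dual)
      then have "?E - (?E - T) = T" by blast
      then show "?E - T \<in> ?cotrees" using iff[of "?E - T"] T by simp
    qed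
    show "?E - (?E - S) = S" if "S \<in> ?cotrees" for S using that by auto
    show "?E - (?E - T) = T" if "T \<in> spanning_trees (dual D)" for T
      using that by (auto simp: spanning_trees_def edges_dual)
  qed
  finally show ?thesis .
qed

end
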